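(* Let $R\ge1$ be a real number, $d\ge1$ an integer, and $\gamma=\frac{(\sqrt{R(R+1)}-R)^2}{4R^2}$ (so $\gamma=\frac{3-2\sqrt2}{4}$ when $R=1$). For every $\varepsilon>0$ there is $N$ (depending on $R,d,\varepsilon$) such that the following holds: for all integers $n\ge N$ and $r\ge1$ and every finite abelian group $G=C_{x_1}\times C_{x_2}\times\cdots\times C_{x_t}$ (with $x_i$ positive integers, each value occurring among $x_1,\dots,x_t$ at most $d$ times) satisfying $r|G|^R\le n$, the number of subgroups of $G$ of order at most $r$ is at most $n^{(\gamma+\varepsilon)\ell(n)}$.
   Context: $C_m$ denotes the cyclic group of order $m$, and $\ell(n)=\frac{\log n}{\log\log n}$. *)

theory Defs
  imports "HOL-Analysis.Analysis" "HOL-Algebra.Elementary_Groups" "HOL-Algebra.Product_Groups"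
begin

definition ell :: "real \<Rightarrow> real" where
  "ell n = ln n / ln (ln n)"

definition gamma_R :: "real \<Rightarrow> real" where
  "gamma_R R = (sqrt (R * (R + 1)) - R)^2 / (4 * R^2)"

definition cyc_prod :: "nat \<Rightarrow> (nat \<Rightarrow> nat) \<Rightarrow> (nat \<Rightarrow> int) monoid" where
  "cyc_prod t x = product_group {..<t} (\<lambda>i. integer_mod_group (x i))"

end

theory Submission
  imports Defs "HOL-Algebra.Multiplicative_Group" "HOL-Real_Asymp.Real_Asymp"
begin

text \<open>
  If \<open>p\<close> is prime and \<open>pH = K\<close>, then \<open>H\<close> lies between \<open>K\<close> and the preimage of \<open>K\<close> under
  multiplication by \<open>p\<close>, and the quotient of the two is elementary abelian of order
  \<open>p\<^sup>\<lambda> = |G[p]|\<close>. So there are about \<open>p\<^bsup>\<mu>(\<lambda>-\<mu>)\<^esup>\<close> such \<open>H\<close> with \<open>|H/K| = p\<^sup>\<mu>\<close>, and iterating over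
  the primes dividing some \<open>U\<close> counts the \<open>H\<close> with prescribed \<open>UH\<close>.
  Put \<open>c = \<surd>(R(R+1)) - R\<close> and \<open>M = 1 - 2c\<close>; then \<open>\<mu>(\<lambda>-\<mu>) \<le> M t (\<mu> + R\<lambda>)\<close> for ranks \<open>\<lambda> \<le> t\<close>,
  and \<open>\<gamma> = M / 4R\<close>.

  Choose \<open>U\<close> composed of the primes at which \<open>G\<close> has rank larger than \<open>T = \<delta> \<ell>(n)\<close>.
  The remaining primes contribute at most about \<open>n\<^sup>T\<close>, so the logarithm of the count is at most
  \<open>M t (log n - R log |UG|)\<close> up to small errors. Here \<open>|UG|\<close> is the product of the
  \<open>v\<^sub>i = x\<^sub>i / gcd(x\<^sub>i, U)\<close>. Since \<open>U\<close> has only \<open>O(log log n)\<close> prime factors, the sum of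
  \<open>u\<^bsup>-\<sigma>\<^esup>\<close> over its divisors is \<open>(log n)\<^bsup>o(1)\<^esup>\<close> for fixed \<open>\<sigma> > 0\<close>, and Rankin's trick turns the
  bounded multiplicity of the \<open>x\<^sub>i\<close> into
  \<open>log |UG| \<ge> (1 - o(1)) t log t - o(log n)\<close>. It remains to maximise the quadratic
  \<open>M t (log n - R t log log n)\<close> in \<open>t\<close>.
\<close>

subsection \<open>Subgroups of finite abelian groups\<close>

locale fin_comm_group = comm_group G for G (structure) +
  assumes finite_carrier: "finite (carrier G)"
begin

section \<open>Kernels and images of power maps\<close>

text \<open>With \<open>pow_set\<close>, the multiplicative form of \<open>A[m]\<close> and
  \<open>mA\<close>: kernel and image of the m-th power map on \<open>A\<close>.\<close>

definition tors :: "nat \<Rightarrow> 'a set \<Rightarrow> 'a set" where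
  "tors m A = {x \<in> A. x [^] m = \<one>}"

definition pow_set :: "nat \<Rightarrow> 'a set \<Rightarrow> 'a set" where
  "pow_set m A = (\<lambda>x. x [^] m) ` A"

text \<open>The subgroup generated by \<open>K\<close> and \<open>x\<close>; natural exponents
  suffice because inverses in a finite group are nonnegative powers.\<close>

definition adjoin :: "'a set \<Rightarrow> 'a \<Rightarrow> 'a set" where
  "adjoin K x = {k \<otimes> x [^] i | k i::nat. k \<in> K}"

lemma subgroup_finite: "subgroup H G \<Longrightarrow> finite H"
  by (meson finite_carrier finite_subset subgroup.subset)

lemma subgroup_card_pos: "subgroup H G \<Longrightarrow> card H > 0"
  by (metis card_gt_0_iff empty_iff subgroup.one_closed subgroup_finite)

lemma finite_subgroups: "finite {H. subgroup H G \<and> P H}"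
  by (rule finite_subset[of _ "Pow (carrier G)"]) (auto simp: finite_carrier dest: subgroup.subset)

lemma subgroup_pow_closed:
  assumes "subgroup A G" "x \<in> A" shows "x [^] (m::nat) \<in> A"
proof (induction m)
  case 0 show ?case using assms subgroup.one_closed by simp
next
  case (Suc m) then show ?case using assms subgroup.m_closed by fastforce
qed

lemma subgroup_tors: assumes "subgroup A G" shows "subgroup (tors m A) G"
proof -
  interpret A: subgroup A G by fact
  show ?thesis
    by unfold_locales (auto simp: tors_def nat_pow_distrib nat_pow_inv)
qed

lemma subgroup_pow_set: assumes "subgroup A G" shows "subgroup (pow_set m A) G"
proof -
  interpret A: subgroup A G by fact
  show ?thesis
  proof (unfold_locales, goal_cases)
    case 1 show ?case by (auto simp: pow_set_def)
  next
    case (2 x y)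
    then obtain a b where "a \<in> A" "b \<in> A" "x = a [^] m" "y = b [^] m" by (auto simp: pow_set_def)
    then show ?case by (auto simp: pow_set_def nat_pow_distrib intro!: image_eqI[of _ _ "a \<otimes> b"])
  next
    case 3 show ?case by (auto simp: pow_set_def intro!: image_eqI[of _ _ \<one>])
  next
    case (4 x)
    then obtain a where "a \<in> A" "x = a [^] m" by (auto simp: pow_set_def)
    then show ?case by (auto simp: pow_set_def nat_pow_inv intro!: image_eqI[of _ _ "inv a"])
  qed
qed

lemma pow_set_subset: "subgroup A G \<Longrightarrow> pow_set m A \<subseteq> A"
  by (auto simp: pow_set_def subgroup_pow_closed)

lemma pow_set_mono: "A \<subseteq> B \<Longrightarrow> pow_set m A \<subseteq> pow_set m B"
  by (auto simp: pow_set_def)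

lemma pow_set_pow_set:
  assumes "subgroup A G" shows "pow_set k (pow_set m A) = pow_set (m * k) A"
  unfolding pow_set_def image_image
  by (rule image_cong) (simp_all add: nat_pow_pow subgroup.mem_carrier[OF assms])

lemma pow_set_1: assumes "subgroup A G" shows "pow_set (Suc 0) A = A"
  using subgroup.mem_carrier[OF assms] by (simp add: pow_set_def cong: image_cong_simp)

lemma tors_mono: "A \<subseteq> B \<Longrightarrow> tors m A \<subseteq> tors m B"
  by (auto simp: tors_def)

text \<open>Each fibre of the power map over its image is a coset of the kernel
  \<open>tors m A\<close>.\<close>

lemma card_pow_set_tors:
  assumes "subgroup A G"
  shows "card A = card (pow_set m A) * card (tors m A)"
proof -
  interpret A: subgroup A G by fact
  have fA: "finite A" by (rule subgroup_finite[OF assms])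
  have fibre: "card {x \<in> A. x [^] m = y} = card (tors m A)" if y: "y \<in> pow_set m A" for y
  proof -
    obtain a where a: "a \<in> A" "y = a [^] m" using y by (auto simp: pow_set_def)
    have "bij_betw (\<lambda>z. a \<otimes> z) (tors m A) {x \<in> A. x [^] m = y}"
    proof (rule bij_betwI[where g = "\<lambda>z. inv a \<otimes> z"])
      show "(\<otimes>) a \<in> tors m A \<rightarrow> {x \<in> A. x [^] m = y}"
        using a by (auto simp: tors_def nat_pow_distrib)
      show "(\<otimes>) (inv a) \<in> {x \<in> A. x [^] m = y} \<rightarrow> tors m A"
        using a by (auto simp: tors_def nat_pow_distrib nat_pow_inv)
    qed (use a in \<open>auto simp: tors_def m_assoc[symmetric]\<close>)
    then show ?thesis by (simp add: bij_betw_same_card)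
  qed
  have "card A = (\<Sum>y\<in>pow_set m A. card {x \<in> A. x [^] m = y})"
    using sum.image_gen[OF fA, of "\<lambda>_. 1::nat" "\<lambda>x. x [^] m"] by (simp add: pow_set_def)
  then show ?thesis using fibre by simp
qed

section \<open>Adjoining one element to a subgroup\<close>

lemma adjoin_extends: "subgroup K G \<Longrightarrow> x \<in> carrier G \<Longrightarrow> K \<subseteq> adjoin K x"
  unfolding adjoin_def by (force intro!: exI[of _ "0::nat"] dest: subgroup.mem_carrier)

lemma adjoin_mem: "subgroup K G \<Longrightarrow> x \<in> carrier G \<Longrightarrow> x \<in> adjoin K x"
  unfolding adjoin_def by (force intro!: exI[of _ "1::nat"] exI[of _ \<one>] dest: subgroup.one_closed)

lemma adjoin_least:
  assumes "subgroup H G" "K \<subseteq> H" "x \<in> H" shows "adjoin K x \<subseteq> H"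
  using assms(2) subgroup.m_closed[OF assms(1) _ subgroup_pow_closed[OF assms(1,3)]]
  by (auto simp: adjoin_def)

lemma subgroup_adjoin:
  assumes K: "subgroup K G" and x: "x \<in> carrier G"
  shows "subgroup (adjoin K x) G"
proof -
  interpret K: subgroup K G by fact
  have m: "(k \<otimes> x [^] i) \<otimes> (k' \<otimes> x [^] j) = (k \<otimes> k') \<otimes> x [^] (i + j)"
    if "k \<in> K" "k' \<in> K" for k k' and i j :: nat
    using that x by (simp add: nat_pow_mult[symmetric] m_ac)
  have "card (carrier G) > 0" using finite_carrier by (simp add: card_gt_0_iff) (use one_closed in blast)
  \<comment> \<open>The inverse of \<open>x\<close> is its power with exponent
    \<open>|G| - 1\<close>, so exponents stay natural.\<close>
  then obtain o' where o: "order G = Suc o'" by (metis order_def gr0_conv_Suc)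
  have "inv (x [^] i) = x [^] (o' * i)" for i :: nat
  proof -
    have "x [^] (o' * i) \<otimes> x [^] i = x [^] (Suc o' * i)"
      using x by (simp add: nat_pow_mult add.commute)
    also have "\<dots> = (x [^] order G) [^] i"
      unfolding o using x by (simp only: nat_pow_pow)
    finally have "x [^] (o' * i) \<otimes> x [^] i = (x [^] order G) [^] i" .
    then show ?thesis using x pow_order_eq_1 by (simp add: inv_equality)
  qed
  then have inv: "inv (k \<otimes> x [^] i) = inv k \<otimes> x [^] (o' * i)" if "k \<in> K" for k and i :: nat
    using that x by (simp add: inv_mult)
  show ?thesis
  proof (unfold_locales, goal_cases)
    case 1 show ?case using x by (auto simp: adjoin_def)
  next
    case (2 a b) then show ?case using m by (fastforce simp: adjoin_def)
  next
    case 3 show ?case using adjoin_extends[OF K x] by auto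
  next
    case (4 a) then show ?case using inv by (fastforce simp: adjoin_def)
  qed
qed

text \<open>Since \<open>p\<close> is prime and \<open>x\<close> is outside \<open>K\<close> with
  its p-th power inside, the powers of \<open>x\<close> with exponents \<open>0, ..., p - 1\<close>
  represent distinct cosets of \<open>K\<close>, and these cosets exhaust
  \<open>adjoin K x\<close>.\<close>

lemma card_adjoin:
  assumes K: "subgroup K G" and x: "x \<in> carrier G" "x \<notin> K" "x [^] p \<in> K" and p: "prime p"
  shows "card (adjoin K x) = card K * p"
proof -
  interpret K: subgroup K G by fact
  have p0: "p > 0" using p prime_gt_0_nat by blast
  have nmem: "x [^] d \<notin> K" if d: "0 < d" "d < p" for d :: nat
  proof
    assume "x [^] d \<in> K"
    have "coprime d p" using p d by (meson coprime_commute nat_dvd_not_less prime_imp_coprime_nat)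
    then obtain a b where ab: "d * a = p * b + 1" using bezout_nat[of d p] d by auto
    have "(x [^] d) [^] a = (x [^] p) [^] b \<otimes> x"
      using x ab by (simp add: nat_pow_pow nat_pow_mult[symmetric])
    then have "x = inv ((x [^] p) [^] b) \<otimes> (x [^] d) [^] a"
      using x by (simp add: m_assoc[symmetric])
    also have "\<dots> \<in> K" using \<open>x [^] d \<in> K\<close> x(3) K by (auto intro!: subgroup_pow_closed)
    finally show False using x(2) by simp
  qed
  define f where "f = (\<lambda>(k,i::nat). k \<otimes> x [^] i)"
  have inj1: "False" if "k \<in> K" "k' \<in> K" "i < j" "j < p" "k \<otimes> x [^] i = k' \<otimes> x [^] j" for k k' and i j :: nat
  proof -
    have "x [^] j = x [^] (j - i) \<otimes> x [^] i" using x \<open>i < j\<close> by (simp add: nat_pow_mult)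
    then have "k = k' \<otimes> x [^] (j - i)"
    proof -
      have "k \<otimes> x [^] i = (k' \<otimes> x [^] (j - i)) \<otimes> x [^] i"
        using that(2,5) x(1) \<open>x [^] j = _\<close> by (simp add: m_assoc)
      then show ?thesis using that(1,2) x(1) by simp
    qed
    then have "x [^] (j - i) = inv k' \<otimes> k" using that x by (simp add: m_assoc[symmetric])
    also have "\<dots> \<in> K" using that by auto
    finally show False using nmem[of "j - i"] that by auto
  qed
  have "inj_on f (K \<times> {..<p})"
  proof (rule inj_onI)
    fix u v assume uv: "u \<in> K \<times> {..<p}" "v \<in> K \<times> {..<p}" "f u = f v"
    obtain a i b j where e: "u = (a, i)" "v = (b, j)" by (meson surj_pair)
    have h: "a \<in> K" "i < p" "b \<in> K" "j < p" "a \<otimes> x [^] i = b \<otimes> x [^] j"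
      using uv by (auto simp: e f_def)
    have "i = j"
      using inj1[of a b i j] inj1[of b a j i] h by (metis linorder_neqE_nat)
    then have "a = b" using h x by simp
    with \<open>i = j\<close> show "u = v" by (simp add: e)
  qed
  moreover have "f ` (K \<times> {..<p}) = adjoin K x"
  proof
    show "f ` (K \<times> {..<p}) \<subseteq> adjoin K x" by (auto simp: f_def adjoin_def)
    show "adjoin K x \<subseteq> f ` (K \<times> {..<p})"
    proof
      fix y assume "y \<in> adjoin K x"
      then obtain k i where y: "k \<in> K" "y = k \<otimes> x [^] (i::nat)" by (auto simp: adjoin_def)
      have "x [^] i = (x [^] p) [^] (i div p) \<otimes> x [^] (i mod p)"
        using x by (simp add: nat_pow_pow nat_pow_mult)
      then have "y = f (k \<otimes> (x [^] p) [^] (i div p), i mod p)"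
        using x y by (simp add: f_def m_assoc)
      moreover have "k \<otimes> (x [^] p) [^] (i div p) \<in> K"
        using y x K by (auto intro!: subgroup_pow_closed)
      ultimately show "y \<in> f ` (K \<times> {..<p})" using p0 by (intro rev_image_eqI) auto
    qed
  qed
  ultimately show ?thesis using card_image[of f "K \<times> {..<p}"] by (simp add: card_cartesian_product)
qed

text \<open>The quotient \<open>H/K\<close> is killed by \<open>p\<close>, so adjoining an element
  of \<open>H\<close> outside \<open>K\<close> multiplies the order by exactly \<open>p\<close>;
  this is repeated until \<open>H\<close> is reached.\<close>

lemma index_prime_power:
  assumes "subgroup K G" "subgroup H G" "K \<subseteq> H" "\<And>x. x \<in> H \<Longrightarrow> x [^] p \<in> K" and p: "prime p"
  shows "\<exists>\<mu>. card H = card K * p ^ \<mu>"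
  using assms(1-4)
proof (induction "card H - card K" arbitrary: K rule: less_induct)
  case less
  show ?case
  proof (cases "K = H")
    case True then show ?thesis by (intro exI[of _ 0]) simp
  next
    case False
    then obtain x where x: "x \<in> H" "x \<notin> K" using less by auto
    then have xc: "x \<in> carrier G" using subgroup.mem_carrier[OF less.prems(2)] by simp
    define K' where "K' = adjoin K x"
    have K': "subgroup K' G" "K \<subseteq> K'" "K' \<subseteq> H"
      unfolding K'_def using less.prems x xc
      by (simp_all only: subgroup_adjoin adjoin_extends adjoin_least)
    have c: "card K' = card K * p" using card_adjoin[OF _ xc x(2) _ p] less.prems x K'_def by simp
    have "K \<subset> K'" using K' x adjoin_mem[OF less.prems(1) xc] unfolding K'_def by auto
    then have "card K < card K'" using K' subgroup_finite by (simp add: psubset_card_mono)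
    moreover have "card K' \<le> card H" using K' less.prems subgroup_finite by (simp add: card_mono)
    ultimately obtain \<mu> where "card H = card K' * p ^ \<mu>"
      using less.hyps[of K'] K' less.prems by (metis diff_less_mono2 order_less_le_trans subsetD)
    then show ?thesis using c by (intro exI[of _ "Suc \<mu>"]) simp
  qed
qed

text \<open>The preceding lemma with trivial \<open>K\<close>; the exponent is the p-rank of
  \<open>A\<close>.\<close>

lemma card_tors_prime_power:
  assumes "subgroup A G" "prime p" shows "\<exists>\<mu>. card (tors p A) = p ^ \<mu>"
proof -
  have "\<exists>\<mu>. card (tors p A) = card {\<one>} * p ^ \<mu>"
    by (rule index_prime_power)
      (use assms in \<open>auto simp: triv_subgroup subgroup_tors subgroup.one_closed, auto simp: tors_def\<close>)
  then show ?thesis by simp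
qed

section \<open>Counting subgroups between two given ones\<close>

text \<open>Each entry may be any element of \<open>H\<close> outside the subgroup built so far.
  That subgroup has index at least \<open>p \<ge> 2\<close> in \<open>H\<close>, so at least half of
  \<open>H\<close>, hence at least \<open>|H|/p\<close> elements, are available at each of the
  \<open>\<mu>\<close> steps.\<close>

lemma count_generating_lists:
  assumes "subgroup K G" "subgroup H G" "K \<subseteq> H" "\<And>x. x \<in> H \<Longrightarrow> x [^] p \<in> K" "prime p"
    and "card H = card K * p ^ \<mu>"
  shows "(card H div p) ^ \<mu> \<le> card {xs. set xs \<subseteq> H \<and> length xs = \<mu> \<and> foldl adjoin K xs = H}"
  using assms(1,3,4,6)
proof (induction \<mu> arbitrary: K)
  case 0
  then have "K = H" using card_subset_eq[of H K] subgroup_finite assms(2) by simp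
  then have "{xs. set xs \<subseteq> H \<and> length xs = 0 \<and> foldl adjoin K xs = H} = {[]}" by auto
  then show ?case by simp
next
  case (Suc \<mu>)
  note p = \<open>prime p\<close>
  have p0: "p > 0" using p prime_gt_0_nat by blast
  define S where "S = (\<lambda>K \<mu>. {xs. set xs \<subseteq> H \<and> length xs = \<mu> \<and> foldl adjoin K xs = H})"
  have finS: "finite (S K \<mu>)" for K \<mu>
    unfolding S_def
    by (rule finite_subset[OF _ finite_lists_length_eq[of H \<mu>]]) (use assms(2) subgroup_finite in auto)
  let ?c = "card H div p"
  have c: "?c = card K * p ^ \<mu>" using Suc.prems p0 by simp
  have cS: "?c ^ \<mu> \<le> card (S (adjoin K x) \<mu>)" if x: "x \<in> H - K" for x
  proof -
    have xc: "x \<in> carrier G" using x subgroup.mem_carrier[OF assms(2)] by simp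
    show ?thesis unfolding S_def
    proof (rule Suc.IH)
      show "subgroup (adjoin K x) G" using subgroup_adjoin Suc.prems xc by blast
      show "adjoin K x \<subseteq> H" using adjoin_least Suc.prems assms(2) x by auto
      show "y [^] p \<in> adjoin K x" if "y \<in> H" for y
        using adjoin_extends[OF Suc.prems(1) xc] Suc.prems(3) that by auto
      have "card (adjoin K x) = card K * p"
        by (rule card_adjoin) (use Suc.prems x xc p in auto)
      then show "card H = card (adjoin K x) * p ^ \<mu>" using Suc.prems by simp
    qed
  qed
  \<comment> \<open>With \<open>c = |H|/p\<close>: \<open>|H| = p c \<ge> 2 c\<close> and
    \<open>|K| \<le> c\<close>, so \<open>|H| - |K| \<ge> c\<close>.\<close>
  have "card (H - K) = card K * (p * p ^ \<mu>) - card K"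
    using Suc.prems assms(2) subgroup_finite by (simp add: card_Diff_subset)
  moreover have "card K * (2 * p ^ \<mu>) \<le> card K * (p * p ^ \<mu>)"
    using prime_ge_2_nat[OF p] by (intro mult_left_mono mult_right_mono) auto
  moreover have "card K * 1 \<le> card K * p ^ \<mu>" using p0 by (intro mult_left_mono) auto
  ultimately have cHK: "?c \<le> card (H - K)" unfolding c by linarith
  have "?c ^ Suc \<mu> \<le> card (H - K) * ?c ^ \<mu>" using cHK by simp
  also have "\<dots> = (\<Sum>x\<in>H - K. ?c ^ \<mu>)" by simp
  also have "\<dots> \<le> (\<Sum>x\<in>H - K. card (S (adjoin K x) \<mu>))" using cS by (intro sum_mono) auto
  also have "\<dots> = card (SIGMA x:H - K. S (adjoin K x) \<mu>)"
    using subgroup_finite[OF assms(2)] finS by (subst card_SigmaI) auto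
  also have "\<dots> = card ((\<lambda>(x, xs). x # xs) ` (SIGMA x:H - K. S (adjoin K x) \<mu>))"
    by (rule card_image[symmetric]) (auto simp: inj_on_def)
  also have "\<dots> \<le> card (S K (Suc \<mu>))"
    by (rule card_mono[OF finS]) (auto simp: S_def)
  finally show ?case unfolding S_def .
qed

text \<open>Double counting of generating lists: each \<open>H\<close> has at least
  \<open>(|H|/p)^\<mu>\<close> of them, a list determines its \<open>H\<close> through
  \<open>foldl\<close>, and there are \<open>|B|^\<mu>\<close> lists over \<open>B\<close>. So there
  are at most \<open>p^(\<mu> (e - \<mu> + 1))\<close> such \<open>H\<close>; the factor
  \<open>p ^ (\<mu> * \<mu>)\<close> is kept on the left to avoid natural subtraction.\<close>

lemma card_intermediate_subgroups:
  assumes K: "subgroup K G" and B: "subgroup B G" "\<And>x. x \<in> B \<Longrightarrow> x [^] p \<in> K" and p: "prime p"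
    and cB: "card B \<le> card K * p ^ e"
  shows "card {H. subgroup H G \<and> K \<subseteq> H \<and> H \<subseteq> B \<and> card H = card K * p ^ \<mu>} * p ^ (\<mu> * \<mu>)
           \<le> p ^ (\<mu> * (e + 1))"
proof -
  have p0: "p > 0" using p prime_gt_0_nat by blast
  let ?F = "{H. subgroup H G \<and> K \<subseteq> H \<and> H \<subseteq> B \<and> card H = card K * p ^ \<mu>}"
  let ?c = "card K * p ^ \<mu> div p"
  define S where "S = (\<lambda>H. {xs. set xs \<subseteq> H \<and> length xs = \<mu> \<and> foldl adjoin K xs = H})"
  let ?L = "{xs. set xs \<subseteq> B \<and> length xs = \<mu>}"
  have finB: "finite B" using B subgroup_finite by blast
  have finS: "finite (S H)" if "H \<in> ?F" for H
    unfolding S_def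
    by (rule finite_subset[OF _ finite_lists_length_eq[of H \<mu>]]) (use that subgroup_finite in blast)+
  have "card ?F * ?c ^ \<mu> = (\<Sum>H\<in>?F. ?c ^ \<mu>)" by simp
  also have "\<dots> \<le> (\<Sum>H\<in>?F. card (S H))"
  proof (rule sum_mono)
    fix H assume "H \<in> ?F"
    then have H: "subgroup H G" "K \<subseteq> H" "H \<subseteq> B" and cH: "card H = card K * p ^ \<mu>" by auto
    have "(card H div p) ^ \<mu> \<le> card (S H)"
      unfolding S_def by (rule count_generating_lists[OF K H(1,2) _ p cH]) (use B H in auto)
    then show "?c ^ \<mu> \<le> card (S H)" by (simp only: cH)
  qed
  also have "\<dots> = card (\<Union>H\<in>?F. S H)"
  proof (rule card_UN_disjoint[symmetric])
    show "finite ?F" by (rule finite_subgroups)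
    show "\<forall>H\<in>?F. finite (S H)" using finS by blast
    show "\<forall>H\<in>?F. \<forall>H'\<in>?F. H \<noteq> H' \<longrightarrow> S H \<inter> S H' = {}" unfolding S_def by blast
  qed
  also have "\<dots> \<le> card ?L"
    by (rule card_mono[OF finite_lists_length_eq[OF finB]]) (auto simp: S_def)
  also have "\<dots> = card B ^ \<mu>" by (rule card_lists_length_eq[OF finB])
  also have "\<dots> \<le> (card K * p ^ e) ^ \<mu>" using cB by (rule power_mono) simp
  finally have main: "card ?F * ?c ^ \<mu> \<le> (card K * p ^ e) ^ \<mu>" .
  show ?thesis
  proof (cases \<mu>)
    case 0 then show ?thesis using main by simp
  next
    case (Suc m)
    \<comment> \<open>The division is exact because \<open>\<mu> \<ge> 1\<close>; for
      \<open>\<mu> = 0\<close> it may round.\<close>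
    then have c: "?c * p = card K * p ^ \<mu>" using p0 by simp
    have "card ?F * (card K * p ^ \<mu>) ^ \<mu> = card ?F * (?c * p) ^ \<mu>" by (simp only: c)
    also have "\<dots> = card ?F * ?c ^ \<mu> * p ^ \<mu>" by (simp only: power_mult_distrib mult.assoc)
    also have "\<dots> \<le> (card K * p ^ e) ^ \<mu> * p ^ \<mu>" using main by (rule mult_right_mono) simp
    finally have "card K ^ \<mu> * (card ?F * p ^ (\<mu> * \<mu>)) \<le> card K ^ \<mu> * p ^ (\<mu> * (e + 1))"
      by (simp add: power_mult_distrib power_add mult_ac flip: power_mult)
    then show ?thesis using subgroup_card_pos[OF K] by simp
  qed
qed

section \<open>Weighted counts over the fibres of power maps\<close>

text \<open>If \<open>pH = K\<close>, then \<open>H\<close> lies between \<open>K\<close> and its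
  preimage \<open>B\<close> in \<open>A\<close>, and \<open>|H/K| = p^m\<close> with
  \<open>m \<le> e\<close>. For each \<open>m\<close> there are at most
  \<open>p^(m (e - m + 1))\<close> such \<open>H\<close>, of weight \<open>p^(-a m)\<close>, so
  \<open>ab\<close> bounds their share by \<open>p^(b e)\<close>. The \<open>e + 1 \<le> p^e\<close>
  values of \<open>m\<close> account for the \<open>+ 1\<close> in \<open>b + 1\<close>, since
  \<open>|A| / |pA| = p^e\<close>.\<close>

lemma sum_subgroups_over_prime_power_map:
  fixes a b :: real
  assumes A: "subgroup A G" and K: "subgroup K G" and p: "prime p"
    and e: "card (tors p A) = p ^ e"
    and ab: "\<And>m. m \<le> e \<Longrightarrow> real m * (real e - real m + 1) \<le> a * real m + b * real e"
  shows "(\<Sum>H | subgroup H G \<and> H \<subseteq> A \<and> pow_set p H = K. (real (card H) / real (card K)) powr (- a))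
     \<le> (real (card A) / real (card (pow_set p A))) powr (b + 1)" (is "sum ?w ?F \<le> _")
proof -
  have p0: "p > 0" "real p > 1" using p prime_gt_1_nat[OF p] by auto
  have cK: "card K > 0" by (rule subgroup_card_pos[OF K])
  define B where "B = {x \<in> A. x [^] p \<in> K}"
  have BA: "B \<subseteq> A" by (auto simp: B_def)
  have B: "subgroup B G"
  proof -
    interpret A: subgroup A G by fact
    interpret K: subgroup K G by fact
    show ?thesis by unfold_locales (auto simp: B_def nat_pow_distrib nat_pow_inv)
  qed
  have cB: "card B \<le> card K * p ^ e"
  proof -
    \<comment> \<open>The p-th power map sends \<open>B\<close> into \<open>K\<close>, with kernel
      inside \<open>tors p A\<close>.\<close>
    have "card B = card (pow_set p B) * card (tors p B)" by (rule card_pow_set_tors[OF B])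
    also have "\<dots> \<le> card K * card (tors p A)"
      using subgroup_finite[OF K] subgroup_finite[OF subgroup_tors[OF A]]
      by (intro mult_mono card_mono tors_mono BA) (auto simp: B_def pow_set_def)
    finally show ?thesis using e by simp
  qed
  let ?N = "\<lambda>m. {H. subgroup H G \<and> K \<subseteq> H \<and> H \<subseteq> B \<and> card H = card K * p ^ m}"
  have FF: "K \<subseteq> H \<and> H \<subseteq> B \<and> (\<exists>m\<le>e. card H = card K * p ^ m)" if H: "H \<in> ?F" for H
  proof -
    have h: "subgroup H G" "H \<subseteq> A" "pow_set p H = K" using H by auto
    have KH: "K \<subseteq> H" using pow_set_subset[OF h(1), of p] h(3) by simp
    have HB: "H \<subseteq> B" using h by (auto simp: B_def pow_set_def)
    obtain m where m: "card H = card K * p ^ m"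
      using index_prime_power[OF K h(1) KH _ p] HB unfolding B_def by blast
    \<comment> \<open>As \<open>K = pH\<close>, the index of \<open>K\<close> in \<open>H\<close> is
      the order of the p-torsion of \<open>H\<close>, which is at most that of
      \<open>A\<close>.\<close>
    have "card (tors p H) = p ^ m"
      using card_pow_set_tors[OF h(1), of p] m cK h(3) by simp
    moreover have "card (tors p H) \<le> card (tors p A)"
      by (intro card_mono tors_mono h subgroup_finite subgroup_tors A)
    ultimately have "m \<le> e" using e p0 by simp
    with KH HB m show ?thesis by blast
  qed
  have cN: "real (card (?N m)) \<le> real p powr (real m * (real e - real m + 1))" for m
  proof -
    have "card (?N m) * p ^ (m * m) \<le> p ^ (m * (e + 1))"
      by (rule card_intermediate_subgroups[OF K B _ p cB]) (simp add: B_def)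
    then have "real (card (?N m)) * real p ^ (m * m) \<le> real p ^ (m * (e + 1))"
      by (simp only: of_nat_le_iff flip: of_nat_power of_nat_mult)
    then have "real (card (?N m)) * real p powr (real m * real m) \<le> real p powr (real m * (real e + 1))"
      using p0 by (simp add: powr_realpow[symmetric] algebra_simps)
    moreover have "real p powr (real m * (real e + 1)) =
        real p powr (real m * (real e - real m + 1)) * real p powr (real m * real m)"
      by (simp add: powr_add[symmetric] algebra_simps)
    ultimately show ?thesis using p0 by simp
  qed
  have inj: "inj_on (\<lambda>m. card K * p ^ m) {..e}"
    using p0 cK by (auto simp: inj_on_def)
  have "sum ?w ?F = (\<Sum>y\<in>(\<lambda>m. card K * p ^ m) ` {..e}. sum ?w {H \<in> ?F. card H = y})"
    by (rule sum.group[symmetric]) (use FF finite_subgroups in fastforce)+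
  also have "\<dots> = (\<Sum>m\<le>e. sum ?w {H \<in> ?F. card H = card K * p ^ m})"
    using inj by (simp add: sum.reindex)
  also have "\<dots> \<le> (\<Sum>m\<le>e. real p powr (b * real e))"
  proof (rule sum_mono)
    fix m assume m: "m \<in> {..e}"
    have "sum ?w {H \<in> ?F. card H = card K * p ^ m} = 
        (\<Sum>H\<in>{H \<in> ?F. card H = card K * p ^ m}. real p powr (- a * real m))"
      using cK p0 by (intro sum.cong refl) (simp add: powr_realpow[symmetric] powr_powr mult.commute)
    also have "\<dots> = real (card {H \<in> ?F. card H = card K * p ^ m}) * real p powr (- a * real m)"
      by simp
    also have "\<dots> \<le> real (card (?N m)) * real p powr (- a * real m)"
      by (intro mult_right_mono of_nat_mono card_mono finite_subgroups) (use FF in auto)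
    also have "\<dots> \<le> real p powr (real m * (real e - real m + 1)) * real p powr (- a * real m)"
      by (intro mult_right_mono cN) simp
    also have "\<dots> \<le> real p powr (b * real e)"
      unfolding powr_add[symmetric] using p0 ab[of m] m by (intro powr_mono) auto
    finally show "sum ?w {H \<in> ?F. card H = card K * p ^ m} \<le> real p powr (b * real e)" .
  qed
  also have "\<dots> = real (Suc e) * real p powr (b * real e)" by simp
  also have "\<dots> \<le> real p powr real e * real p powr (b * real e)"
  proof (rule mult_right_mono)
    have "Suc e \<le> 2 ^ e" by (simp add: Suc_leI)
    also have "\<dots> \<le> p ^ e" using prime_ge_2_nat[OF p] by (rule power_mono) simp
    finally have "real (Suc e) \<le> real p ^ e" by (simp only: of_nat_le_iff flip: of_nat_power)
    then show "real (Suc e) \<le> real p powr real e" using p0 by (simp add: powr_realpow)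
  qed simp
  also have "\<dots> = (real p ^ e) powr (b + 1)"
    using p0 by (simp add: powr_realpow[symmetric] powr_powr powr_add[symmetric] algebra_simps)
  also have "real p ^ e = real (card A) / real (card (pow_set p A))"
    using card_pow_set_tors[OF A, of p] e subgroup_card_pos[OF subgroup_pow_set[OF A, of p]] by simp
  finally show ?thesis .
qed

text \<open>Induction over the prime factors: with \<open>U = p V\<close>, group the
  \<open>H\<close> by \<open>H' = pH\<close>. The weights split as
  \<open>|H|/|K| = (|H|/|H'|) (|H'|/|K|)\<close>, and the bounds for \<open>A\<close> over
  \<open>pA\<close> and for \<open>pA\<close> over \<open>UA\<close> telescope. \<open>A\<close>
  varies because it is replaced by \<open>pA\<close>, whose ranks are no larger.\<close>

lemma sum_subgroups_over_power_map:
  fixes a b :: real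
  assumes "subgroup A G" "subgroup K G" "U > 0"
    and "\<And>p. prime p \<Longrightarrow> card (tors p A) \<le> p ^ t"
    and ab: "\<And>e m. m \<le> e \<Longrightarrow> e \<le> t \<Longrightarrow> real m * (real e - real m + 1) \<le> a * real m + b * real e"
  shows "(\<Sum>H | subgroup H G \<and> H \<subseteq> A \<and> pow_set U H = K. (real (card H) / real (card K)) powr (- a))
     \<le> (real (card A) / real (card (pow_set U A))) powr (b + 1)"
  using assms(1,3,4)
proof (induction U arbitrary: A rule: less_induct)
  case (less U)
  note A = \<open>subgroup A G\<close> and K = \<open>subgroup K G\<close>
  let ?w = "\<lambda>K H. (real (card H) / real (card K)) powr (- a)"
  show ?case
  proof (cases "U = 1")
    case True
    have "(\<Sum>H | subgroup H G \<and> H \<subseteq> A \<and> pow_set U H = K. ?w K H) \<le> (\<Sum>H\<in>{K}. ?w K H)"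
      by (rule sum_mono2) (auto simp: True pow_set_1)
    then show ?thesis using subgroup_card_pos[OF A] subgroup_card_pos[OF K]
      by (simp add: True pow_set_1 A)
  next
    case False
    then obtain p V where p: "prime p" "U = p * V" by (metis dvdE prime_factor_nat)
    then have V: "V > 0" "V < U" using less.prems(2) prime_gt_1_nat[OF p(1)] by auto
    define A' where "A' = pow_set p A"
    have A': "subgroup A' G" "A' \<subseteq> A" unfolding A'_def using A by (simp_all add: subgroup_pow_set pow_set_subset)
    obtain e where e: "card (tors p A) = p ^ e" using card_tors_prime_power[OF A p(1)] by blast
    have "e \<le> t" using less.prems(3)[OF p(1)] e prime_gt_1_nat[OF p(1)] by simp
    let ?F = "{H. subgroup H G \<and> H \<subseteq> A \<and> pow_set U H = K}"
    let ?F' = "{H. subgroup H G \<and> H \<subseteq> A' \<and> pow_set V H = K}"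
    have pp: "pow_set V (pow_set p H) = pow_set U H" if "subgroup H G" for H
      using pow_set_pow_set[OF that] p by simp
    have "sum (?w K) ?F = (\<Sum>H'\<in>?F'. sum (?w K) {H \<in> ?F. pow_set p H = H'})"
      by (rule sum.group[symmetric])
        (auto simp: finite_subgroups pp A'_def subgroup_pow_set intro: subsetD[OF pow_set_mono])
    also have "\<dots> \<le> (\<Sum>H'\<in>?F'. ?w K H' * (real (card A) / real (card A')) powr (b + 1))"
    proof (rule sum_mono)
      fix H' assume "H' \<in> ?F'"
      then have H': "subgroup H' G" "pow_set V H' = K" by auto
      have "{H \<in> ?F. pow_set p H = H'} = {H. subgroup H G \<and> H \<subseteq> A \<and> pow_set p H = H'}"
        using pp H' by auto
      moreover have w: "?w K H = ?w K H' * ?w H' H" for H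
        using subgroup_card_pos[OF H'(1)] by (simp add: powr_mult[symmetric])
      ultimately have "sum (?w K) {H \<in> ?F. pow_set p H = H'} =
          ?w K H' * (\<Sum>H | subgroup H G \<and> H \<subseteq> A \<and> pow_set p H = H'. ?w H' H)"
        unfolding sum_distrib_left by (intro sum.cong) (simp, rule w)
      also have "\<dots> \<le> ?w K H' * (real (card A) / real (card A')) powr (b + 1)"
        unfolding A'_def
        by (intro mult_left_mono sum_subgroups_over_prime_power_map[OF A H'(1) p(1) e] ab \<open>e \<le> t\<close>) auto
      finally show "sum (?w K) {H \<in> ?F. pow_set p H = H'} \<le> \<dots>" .
    qed
    also have "\<dots> = (\<Sum>H'\<in>?F'. ?w K H') * (real (card A) / real (card A')) powr (b + 1)"
      by (simp add: sum_distrib_right)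
    also have "\<dots> \<le> (real (card A') / real (card (pow_set V A'))) powr (b + 1) * (real (card A) / real (card A')) powr (b + 1)"
    proof (intro mult_right_mono less.IH V A')
      show "card (tors q A') \<le> q ^ t" if "prime q" for q
      proof -
        have "card (tors q A') \<le> card (tors q A)"
          by (intro card_mono tors_mono A' subgroup_finite subgroup_tors A)
        then show ?thesis using less.prems(3)[OF that] by simp
      qed
    qed auto
    also have "\<dots> = (real (card A) / real (card (pow_set U A))) powr (b + 1)"
      using subgroup_card_pos[OF A'(1)] pp[OF A] by (simp add: powr_mult[symmetric] A'_def)
    finally show ?thesis .
  qed
qed

text \<open>The power map with exponent \<open>|G|\<close> sends every subgroup to the trivial one,
  so taking \<open>U = |G|\<close> and \<open>a = 0\<close> in the weighted count counts all
  subgroups of \<open>A\<close>. Then \<open>b = T + 1\<close> is admissible, because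
  \<open>m (e - m + 1) \<le> e (T + 1)\<close>.\<close>

lemma card_subgroups_le_of_rank_le:
  assumes A: "subgroup A G" and T: "\<And>p. prime p \<Longrightarrow> card (tors p A) \<le> p ^ T"
  shows "real (card {H. subgroup H G \<and> H \<subseteq> A}) \<le> real (card A) powr (real T + 2)"
proof -
  have o: "order G > 0" using finite_carrier by (simp add: order_gt_0_iff_finite)
  have one: "pow_set (order G) H = {\<one>}" if "subgroup H G" for H
  proof -
    have "(\<lambda>x. x [^] order G) ` H = (\<lambda>x. \<one>) ` H"
      using subgroup.mem_carrier[OF that] by (intro image_cong) (simp_all add: pow_order_eq_1)
    then show ?thesis using subgroup.one_closed[OF that] by (auto simp: pow_set_def)
  qed
  have "{H. subgroup H G \<and> H \<subseteq> A} = {H. subgroup H G \<and> H \<subseteq> A \<and> pow_set (order G) H = {\<one>}}"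
    using one by auto
  then have "real (card {H. subgroup H G \<and> H \<subseteq> A}) =
      (\<Sum>H | subgroup H G \<and> H \<subseteq> A \<and> pow_set (order G) H = {\<one>}. 1)"
    by simp
  also have "\<dots> = (\<Sum>H | subgroup H G \<and> H \<subseteq> A \<and> pow_set (order G) H = {\<one>}. (real (card H) / real (card {\<one>})) powr (- 0))"
  proof (intro sum.cong refl)
    fix H assume "H \<in> {H. subgroup H G \<and> H \<subseteq> A \<and> pow_set (order G) H = {\<one>}}"
    \<comment> \<open>Since \<open>0 powr 0 = 0\<close>, the weight is 1 only for a nonzero
      base.\<close>
    then have "card H > 0" using subgroup_card_pos by blast
    then show "1 = (real (card H) / real (card {\<one>})) powr (- 0)" by simp
  qed
  also have "\<dots> \<le> (real (card A) / real (card (pow_set (order G) A))) powr ((real T + 1) + 1)"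
  proof (rule sum_subgroups_over_power_map[OF A triv_subgroup o T])
    fix e m assume "m \<le> e" "e \<le> T"
    then have "real m * (real e - real m + 1) \<le> real e * (real T + 1)"
      by (intro mult_mono) auto
    then show "real m * (real e - real m + 1) \<le> 0 * real m + (real T + 1) * real e"
      by (simp add: mult.commute)
  qed
  finally show ?thesis by (simp add: one[OF A] add.commute)
qed

text \<open>A \<open>U\<close> minimising \<open>|UG|\<close> works: a prime of rank above \<open>T\<close> in \<open>UG\<close> could be multiplied in.\<close>

lemma exists_low_rank_power:
  "\<exists>U>0. (\<forall>p. prime p \<and> p dvd U \<longrightarrow> p ^ T < card (tors p (carrier G))) \<and>
         (\<forall>p. prime p \<longrightarrow> card (tors p (pow_set U (carrier G))) \<le> p ^ T)"
proof -
  let ?P = "\<lambda>U. U > 0 \<and> (\<forall>p. prime p \<and> p dvd U \<longrightarrow> p ^ T < card (tors p (carrier G)))"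
  have G: "subgroup (carrier G) G" by (rule subgroup_self)
  have "?P 1" using not_prime_unit by auto
  then obtain U where U: "?P U"
    and min: "\<And>V. ?P V \<Longrightarrow> card (pow_set U (carrier G)) \<le> card (pow_set V (carrier G))"
    using ex_has_least_nat[of ?P 1 "\<lambda>U. card (pow_set U (carrier G))"] by blast
  have sU: "subgroup (pow_set U (carrier G)) G" by (rule subgroup_pow_set[OF G])
  have "card (tors p (pow_set U (carrier G))) \<le> p ^ T" if p: "prime p" for p
  proof (rule ccontr)
    assume n: "\<not> ?thesis"
    have "card (tors p (pow_set U (carrier G))) \<le> card (tors p (carrier G))"
      by (intro card_mono tors_mono pow_set_subset G subgroup_finite subgroup_tors)
    then have "p ^ T < card (tors p (carrier G))" using n by linarith
    moreover have "q dvd U \<or> q = p" if "prime q" "q dvd U * p" for q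
      using that p prime_dvd_mult_iff[OF that(1)] primes_dvd_imp_eq by blast
    ultimately have "?P (U * p)" using U prime_gt_0_nat[OF p] by auto
    from min[OF this] have "card (pow_set U (carrier G)) \<le> card (pow_set p (pow_set U (carrier G)))"
      by (simp add: pow_set_pow_set[OF G])
    moreover have "card (pow_set U (carrier G)) =
        card (pow_set p (pow_set U (carrier G))) * card (tors p (pow_set U (carrier G)))"
      by (rule card_pow_set_tors[OF sU])
    moreover have "card (pow_set p (pow_set U (carrier G))) > 0"
      by (intro subgroup_card_pos subgroup_pow_set sU)
    ultimately have "card (tors p (pow_set U (carrier G))) \<le> 1" by simp
    moreover have "1 \<le> p ^ T" using prime_gt_0_nat[OF p] by simp
    ultimately show False using n by linarith
  qed
  with U show ?thesis by blast
qed

text \<open>Sort the \<open>H\<close> by \<open>K = UH\<close>, a subgroup of \<open>UG\<close>. The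
  small ranks of \<open>UG\<close> leave at most \<open>|UG|^(T + 2)\<close> choices of
  \<open>K\<close>. Within one fibre Rankin's trick applies: \<open>|H|/|K| \<le> r\<close> gives
  \<open>1 \<le> r^a (|H|/|K|)^(-a)\<close>, and the weighted sum is already bounded.\<close>

lemma card_bounded_subgroups_le:
  fixes a b :: real
  assumes "U > 0" "a \<ge> 0"
    and T: "\<And>p. prime p \<Longrightarrow> card (tors p (pow_set U (carrier G))) \<le> p ^ T"
    and t: "\<And>p. prime p \<Longrightarrow> card (tors p (carrier G)) \<le> p ^ t"
    and ab: "\<And>e m. m \<le> e \<Longrightarrow> e \<le> t \<Longrightarrow> real m * (real e - real m + 1) \<le> a * real m + b * real e"
  shows "real (card {H. subgroup H G \<and> card H \<le> r}) \<le>
      real (card (pow_set U (carrier G))) powr (real T + 2) *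
      (real r powr a * (real (order G) / real (card (pow_set U (carrier G)))) powr (b + 1))"
proof -
  have G: "subgroup (carrier G) G" by (rule subgroup_self)
  let ?UG = "pow_set U (carrier G)"
  have sU: "subgroup ?UG G" by (rule subgroup_pow_set[OF G])
  let ?F = "{H. subgroup H G \<and> card H \<le> r}"
  let ?C = "real r powr a * (real (order G) / real (card ?UG)) powr (b + 1)"
  have "real (card {H \<in> ?F. pow_set U H = K}) \<le> ?C" if K: "subgroup K G" for K
  proof -
    let ?S = "{H. subgroup H G \<and> H \<subseteq> carrier G \<and> pow_set U H = K}"
    have "real (card {H \<in> ?F. pow_set U H = K}) = (\<Sum>H\<in>{H \<in> ?F. pow_set U H = K}. 1)" by simp
    also have "\<dots> \<le> (\<Sum>H\<in>{H \<in> ?F. pow_set U H = K}.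
        real r powr a * (real (card H) / real (card K)) powr (- a))"
    proof (rule sum_mono)
      fix H assume "H \<in> {H \<in> ?F. pow_set U H = K}"
      then have H: "subgroup H G" "card H \<le> r" by auto
      have c: "card H > 0" "card K \<ge> 1"
        using subgroup_card_pos[OF H(1)] subgroup_card_pos[OF K] by auto
      have "real (card H) / real (card K) \<le> real (card H) / 1"
        using c by (intro divide_left_mono) auto
      then have "real (card H) / real (card K) \<le> real r" using H(2) by linarith
      then have "(real (card H) / real (card K)) powr a \<le> real r powr a"
        using \<open>a \<ge> 0\<close> by (intro powr_mono2) auto
      then show "1 \<le> real r powr a * (real (card H) / real (card K)) powr (- a)"
        using c by (simp add: powr_minus field_simps)
    qed
    also have "\<dots> \<le> (\<Sum>H\<in>?S. real r powr a * (real (card H) / real (card K)) powr (- a))"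
      by (intro sum_mono2 finite_subgroups) (auto dest: subgroup.subset)
    also have "\<dots> = real r powr a * (\<Sum>H\<in>?S. (real (card H) / real (card K)) powr (- a))"
      by (simp add: sum_distrib_left)
    also have "\<dots> \<le> real r powr a * (real (card (carrier G)) / real (card ?UG)) powr (b + 1)"
      by (intro mult_left_mono sum_subgroups_over_power_map[OF G K \<open>U > 0\<close> t ab]) auto
    finally show ?thesis by (simp add: order_def)
  qed
  note fibre = this
  have "card ?F = (\<Sum>K\<in>{K. subgroup K G \<and> K \<subseteq> ?UG}. card {H \<in> ?F. pow_set U H = K})"
    using sum.group[of ?F "{K. subgroup K G \<and> K \<subseteq> ?UG}" "pow_set U" "\<lambda>_. 1::nat"] finite_subgroups
    by (simp add: image_subset_iff subgroup_pow_set pow_set_mono subgroup.subset)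
  then have "real (card ?F) = (\<Sum>K\<in>{K. subgroup K G \<and> K \<subseteq> ?UG}. real (card {H \<in> ?F. pow_set U H = K}))"
    by simp
  also have "\<dots> \<le> (\<Sum>K\<in>{K. subgroup K G \<and> K \<subseteq> ?UG}. ?C)"
    by (rule sum_mono) (use fibre in blast)
  also have "\<dots> = real (card {K. subgroup K G \<and> K \<subseteq> ?UG}) * ?C" by simp
  also have "\<dots> \<le> real (card ?UG) powr (real T + 2) * ?C"
    by (intro mult_right_mono card_subgroups_le_of_rank_le sU T) auto
  finally show ?thesis .
qed

end

subsection \<open>Products of cyclic groups\<close>

lemma fin_comm_group_cyc_prod:
  assumes "\<forall>i<t. x i > 0"
  shows "fin_comm_group (cyc_prod t x)"
proof -
  have "group (cyc_prod t x)" by (simp add: cyc_prod_def)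
  then have "comm_group (cyc_prod t x)"
    by (rule group.group_comm_groupI)
      (auto simp: cyc_prod_def fun_eq_iff add.commute)
  \<comment> \<open>Positivity enters here: \<open>integer_mod_group 0\<close> is infinite
    cyclic.\<close>
  moreover have "finite (carrier (cyc_prod t x))"
    using assms by (auto simp: cyc_prod_def carrier_integer_mod_group intro!: finite_PiE)
  ultimately show ?thesis by (simp add: fin_comm_group_def fin_comm_group_axioms_def)
qed

lemma pow_product_group:
  assumes "f \<in> extensional I"
  shows "f [^]\<^bsub>product_group I G\<^esub> (m::nat) = (\<lambda>i\<in>I. f i [^]\<^bsub>G i\<^esub> m)"
  by (induction m) (auto simp: nat_pow_def fun_eq_iff restrict_def)

text \<open>With \<open>g = gcd x m\<close>, the number \<open>y = x/g\<close> is coprime to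
  \<open>m/g\<close>, so \<open>x\<close> divides \<open>m a\<close> iff \<open>y\<close> divides
  \<open>a\<close>. Exactly \<open>g\<close> multiples of \<open>y\<close> lie in
  \<open>{0..<x}\<close>, as \<open>x = g y\<close>.\<close>

lemma card_annihilator_mod:
  assumes "x > 0"
  shows "card {a \<in> {0..<int x}. (int m * a) mod int x = 0} = gcd x m"
proof -
  define g where "g = gcd x m"
  define y where "y = x div g"
  define n where "n = m div g"
  have g: "g > 0" using assms by (simp add: g_def)
  have e: "x = g * y" "m = g * n" by (simp_all add: y_def n_def g_def)
  have y0: "y > 0" using e(1) assms by (metis gr0I mult_0_right)
  have "coprime y n" unfolding y_def n_def g_def using assms by (intro div_gcd_coprime) simp
  then have cop: "coprime (int y) (int n)" by simp
  have "int x dvd int m * a \<longleftrightarrow> int y dvd a" for a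
  proof -
    have "int x dvd int m * a \<longleftrightarrow> int g * int y dvd int g * (int n * a)"
      by (metis e mult.assoc of_nat_mult)
    also have "\<dots> \<longleftrightarrow> int y dvd int n * a" using g by simp
    also have "\<dots> \<longleftrightarrow> int y dvd a" using cop by (rule coprime_dvd_mult_right_iff)
    finally show ?thesis .
  qed
  then have "{a \<in> {0..<int x}. (int m * a) mod int x = 0} = {a \<in> {0..<int x}. int y dvd a}"
    by (auto simp: mod_eq_0_iff_dvd)
  also have "\<dots> = (\<lambda>k. int (y * k)) ` {..<g}"
  proof (intro equalityI subsetI)
    fix a assume "a \<in> {a \<in> {0..<int x}. int y dvd a}"
    then have a: "0 \<le> a" "a < int x" "int y dvd a" by auto
    then obtain j where j: "a = int y * j" by blast
    then have "j \<ge> 0" using a(1) y0 by (simp add: zero_le_mult_iff)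
    then obtain k where k: "j = int k" using nonneg_int_cases by blast
    have "int y * int k < int y * int g" using a(2) by (simp add: j k e(1) mult.commute)
    then have "k < g" using y0 by simp
    then show "a \<in> (\<lambda>k. int (y * k)) ` {..<g}" by (auto simp: j k)
  next
    fix a assume "a \<in> (\<lambda>k. int (y * k)) ` {..<g}"
    then obtain k where k: "k < g" "a = int (y * k)" by auto
    then have "y * k < y * g" using y0 by simp
    then have "y * k < x" using e(1) by (metis mult.commute)
    then have "a < int x" unfolding k(2) by (simp only: of_nat_less_iff)
    then show "a \<in> {a \<in> {0..<int x}. int y dvd a}" using k by simp
  qed
  also have "card \<dots> = g"
    using y0 by (subst card_image) (auto simp: inj_on_def)
  finally show ?thesis by (simp add: g_def)
qed

section \<open>Torsion, images and ranks of a product of cyclic groups\<close>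

context
  fixes t :: nat and x :: "nat \<Rightarrow> nat"
  assumes pos: "\<forall>i<t. x i > 0"
begin

interpretation G: fin_comm_group "cyc_prod t x"
  by (rule fin_comm_group_cyc_prod[OF pos])

lemma order_cyc_prod: "order (cyc_prod t x) = (\<Prod>i<t. x i)"
  using pos by (auto simp: order_def cyc_prod_def card_PiE carrier_integer_mod_group intro!: prod.cong)

text \<open>Powers are taken coordinatewise, so the torsion is the product of the sets counted in
  \<open>card_annihilator_mod\<close>.\<close>

lemma card_tors_cyc_prod:
  "card (G.tors m (carrier (cyc_prod t x))) = (\<Prod>i<t. gcd (x i) m)"
proof -
  have "G.tors m (carrier (cyc_prod t x)) =
      (\<Pi>\<^sub>E i\<in>{..<t}. {a \<in> {0..<int (x i)}. (int m * a) mod int (x i) = 0})"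
  proof (intro equalityI subsetI)
    fix f assume "f \<in> G.tors m (carrier (cyc_prod t x))"
    then have f: "f \<in> (\<Pi>\<^sub>E i\<in>{..<t}. carrier (integer_mod_group (x i)))"
      and e: "f [^]\<^bsub>cyc_prod t x\<^esub> m = \<one>\<^bsub>cyc_prod t x\<^esub>"
      by (simp_all add: G.tors_def) (simp add: cyc_prod_def)
    have "(\<lambda>i\<in>{..<t}. f i [^]\<^bsub>integer_mod_group (x i)\<^esub> m) = (\<lambda>i\<in>{..<t}. 0)"
      using e pow_product_group[of f "{..<t}" "\<lambda>i. integer_mod_group (x i)" m] f
      by (simp add: cyc_prod_def PiE_iff del: pow_integer_mod_group)
    then have "(int m * f i) mod int (x i) = 0" if "i < t" for i
      using that by (auto dest!: fun_cong[where x = i])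
    with f pos show "f \<in> (\<Pi>\<^sub>E i\<in>{..<t}. {a \<in> {0..<int (x i)}. (int m * a) mod int (x i) = 0})"
      by (auto simp: PiE_iff carrier_integer_mod_group split: if_splits)
  next
    fix f assume f: "f \<in> (\<Pi>\<^sub>E i\<in>{..<t}. {a \<in> {0..<int (x i)}. (int m * a) mod int (x i) = 0})"
    then have "f [^]\<^bsub>cyc_prod t x\<^esub> m = (\<lambda>i\<in>{..<t}. f i [^]\<^bsub>integer_mod_group (x i)\<^esub> m)"
      unfolding cyc_prod_def by (intro pow_product_group) (auto simp: PiE_iff)
    also have "\<dots> = \<one>\<^bsub>cyc_prod t x\<^esub>"
      using f by (auto simp: cyc_prod_def PiE_iff fun_eq_iff)
    finally have "f [^]\<^bsub>cyc_prod t x\<^esub> m = \<one>\<^bsub>cyc_prod t x\<^esub>" .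
    moreover have "f \<in> carrier (cyc_prod t x)"
      using f pos by (auto simp: cyc_prod_def PiE_iff carrier_integer_mod_group)
    ultimately show "f \<in> G.tors m (carrier (cyc_prod t x))" by (simp add: G.tors_def)
  qed
  then have "card (G.tors m (carrier (cyc_prod t x))) =
      (\<Prod>i<t. card {a \<in> {0..<int (x i)}. (int m * a) mod int (x i) = 0})"
    by (simp add: card_PiE)
  also have "\<dots> = (\<Prod>i<t. gcd (x i) m)"
    using pos by (intro prod.cong refl card_annihilator_mod) auto
  finally show ?thesis .
qed

text \<open>\<open>gcd (x i) p\<close> is \<open>p\<close> or 1, so the p-rank is the number of
  \<open>x i\<close> divisible by \<open>p\<close>.\<close>

lemma card_tors_cyc_prod_prime:
  assumes "prime p"
  shows "card (G.tors p (carrier (cyc_prod t x))) = p ^ card {i. i < t \<and> p dvd x i}"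
proof -
  have "gcd (x i) p = (if p dvd x i then p else 1)" for i
    using prime_imp_coprime_nat[OF assms, of "x i"]
    by (auto simp: coprime_iff_gcd_eq_1 gcd.commute)
  then have "card (G.tors p (carrier (cyc_prod t x))) = (\<Prod>i<t. if p dvd x i then p else 1)"
    using card_tors_cyc_prod[of p] by simp
  also have "\<dots> = p ^ card {i. i < t \<and> p dvd x i}"
    by (simp add: prod.If_cases Int_def)
  finally show ?thesis .
qed

text \<open>Order is image times kernel, and the known kernel cancels.\<close>

lemma card_pow_set_cyc_prod:
  assumes "U > 0"
  shows "card (G.pow_set U (carrier (cyc_prod t x))) = (\<Prod>i<t. x i div gcd (x i) U)"
proof -
  let ?g = "\<Prod>i<t. gcd (x i) U"
  have "(\<Prod>i<t. x i) = (\<Prod>i<t. x i div gcd (x i) U) * ?g"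
    by (simp flip: prod.distrib)
  moreover have "(\<Prod>i<t. x i) = card (G.pow_set U (carrier (cyc_prod t x))) * ?g"
    using G.card_pow_set_tors[OF G.subgroup_self, of U]
    by (simp add: card_tors_cyc_prod order_def flip: order_cyc_prod)
  moreover have "?g > 0" using assms by (simp add: prod_pos)
  ultimately show ?thesis by (metis mult_cancel2 less_irrefl)
qed

text \<open>The general count for \<open>cyc_prod\<close>: all ranks are at most the number
  \<open>t\<close> of factors, which matches the range \<open>e \<le> t\<close> in
  \<open>ab\<close>, and a prime of rank above \<open>T\<close> is one dividing more than
  \<open>T\<close> of the \<open>x i\<close>.\<close>

lemma card_bounded_subgroups_cyc_prod_le:
  fixes a b :: real and T r :: nat
  assumes "a \<ge> 0"
    and ab: "\<And>e m. m \<le> e \<Longrightarrow> e \<le> t \<Longrightarrow> real m * (real e - real m + 1) \<le> a * real m + b * real e"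
  obtains U where "U > 0" "\<And>p. prime p \<Longrightarrow> p dvd U \<Longrightarrow> T < card {i. i < t \<and> p dvd x i}"
    "real (card {H. subgroup H (cyc_prod t x) \<and> card H \<le> r}) \<le>
      real (\<Prod>i<t. x i div gcd (x i) U) powr (real T + 2) *
      (real r powr a * (real (\<Prod>i<t. x i) / real (\<Prod>i<t. x i div gcd (x i) U)) powr (b + 1))"
proof -
  obtain U where U: "U > 0"
    "\<And>p. prime p \<Longrightarrow> p dvd U \<Longrightarrow> p ^ T < card (G.tors p (carrier (cyc_prod t x)))"
    "\<And>p. prime p \<Longrightarrow> card (G.tors p (G.pow_set U (carrier (cyc_prod t x)))) \<le> p ^ T"
    using G.exists_low_rank_power[of T] by blast
  have "card {i. i < t \<and> p dvd x i} \<le> t" for p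
    using card_mono[of "{..<t}" "{i. i < t \<and> p dvd x i}"] by fastforce
  then have rank: "card (G.tors p (carrier (cyc_prod t x))) \<le> p ^ t" if "prime p" for p
    using that prime_gt_0_nat[OF that] by (simp add: card_tors_cyc_prod_prime power_increasing)
  have "T < card {i. i < t \<and> p dvd x i}" if "prime p" "p dvd U" for p
    using U(2)[OF that] unfolding card_tors_cyc_prod_prime[OF that(1)]
    by (rule power_less_imp_less_exp[OF prime_gt_1_nat[OF that(1)]])
  moreover note G.card_bounded_subgroups_le[OF U(1) \<open>a \<ge> 0\<close> U(3) rank ab, of r,
      unfolded card_pow_set_cyc_prod[OF U(1)] order_cyc_prod]
  ultimately show ?thesis using that[OF U(1)] by blast
qed

end

subsection \<open>Cofactors of the factors of a product\<close>

text \<open>The divisor function of order \<open>- \<sigma>\<close>; it will account for the parts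
  \<open>gcd (x i) U\<close> of the \<open>x i\<close>.\<close>

definition divisor_powr_sum :: "real \<Rightarrow> nat \<Rightarrow> real" where
  "divisor_powr_sum \<sigma> U = (\<Sum>u | u dvd U. real u powr (- \<sigma>))"

lemma divisor_powr_sum_ge_1:
  assumes "U > 0" shows "divisor_powr_sum \<sigma> U \<ge> 1"
proof -
  have "(\<Sum>u\<in>{1}. real u powr (- \<sigma>)) \<le> divisor_powr_sum \<sigma> U"
    unfolding divisor_powr_sum_def using assms by (intro sum_mono2) auto
  then show ?thesis by simp
qed

text \<open>Every divisor of \<open>A * B\<close> is a product of divisors of \<open>A\<close> and
  \<open>B\<close>, possibly in several ways.\<close>

lemma divisor_powr_sum_mult_le:
  assumes "A > 0" "B > 0"
  shows "divisor_powr_sum \<sigma> (A * B) \<le> divisor_powr_sum \<sigma> A * divisor_powr_sum \<sigma> B"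
proof -
  let ?I = "{u. u dvd A} \<times> {u. u dvd B}"
  have fin: "finite ?I" using assms by simp
  have "{u. u dvd A * B} \<subseteq> (\<lambda>(u, v). u * v) ` ?I"
  proof
    fix u assume "u \<in> {u. u dvd A * B}"
    then obtain b c where "u = b * c" "b dvd A" "c dvd B" using division_decomp[of u A B] by auto
    then show "u \<in> (\<lambda>(u, v). u * v) ` ?I" by force
  qed
  then have "divisor_powr_sum \<sigma> (A * B) \<le> (\<Sum>u\<in>(\<lambda>(u, v). u * v) ` ?I. real u powr (- \<sigma>))"
    unfolding divisor_powr_sum_def using fin by (intro sum_mono2) auto
  also have "\<dots> \<le> (\<Sum>z\<in>?I. ((\<lambda>u. real u powr (- \<sigma>)) \<circ> (\<lambda>(u, v). u * v)) z)"
    by (rule sum_image_le[OF fin]) simp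
  also have "\<dots> = (\<Sum>(u, v)\<in>?I. real u powr (- \<sigma>) * real v powr (- \<sigma>))"
    by (intro sum.cong refl) (auto simp: powr_mult)
  also have "\<dots> = divisor_powr_sum \<sigma> A * divisor_powr_sum \<sigma> B"
    unfolding divisor_powr_sum_def by (simp add: sum_product sum.cartesian_product)
  finally show ?thesis .
qed

text \<open>The full geometric series of the \<open>p^(- \<sigma> i)\<close>.\<close>

definition euler_factor :: "real \<Rightarrow> nat \<Rightarrow> real" where
  "euler_factor \<sigma> p = 1 / (1 - real p powr (- \<sigma>))"

lemma euler_factor_ge_1: "p \<ge> 2 \<Longrightarrow> \<sigma> > 0 \<Longrightarrow> euler_factor \<sigma> p \<ge> 1"
proof -
  assume "p \<ge> 2" "\<sigma> > 0"
  then have "real p powr (- \<sigma>) < 1" by (simp add: powr_minus field_simps)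
  then show ?thesis unfolding euler_factor_def by (simp add: field_simps)
qed

lemma euler_factor_antimono:
  assumes "2 \<le> p" "p \<le> q" "\<sigma> > 0" shows "euler_factor \<sigma> q \<le> euler_factor \<sigma> p"
proof -
  have "real p powr (- \<sigma>) < 1" using assms by (simp add: powr_minus field_simps)
  moreover have "real q powr (- \<sigma>) \<le> real p powr (- \<sigma>)" using assms by (intro powr_mono2') auto
  ultimately show ?thesis unfolding euler_factor_def by (intro divide_left_mono) auto
qed

lemma divisor_powr_sum_prime_power:
  assumes p: "prime p" and "\<sigma> > 0"
  shows "divisor_powr_sum \<sigma> (p ^ k) \<le> euler_factor \<sigma> p"
proof -
  define q where "q = real p powr (- \<sigma>)"
  have p1: "p > 1" by (rule prime_gt_1_nat[OF p])
  have q: "0 \<le> q" "q < 1" using p1 assms by (auto simp: q_def powr_minus field_simps)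
  have "{u. u dvd p ^ k} = (\<lambda>i. p ^ i) ` {..k}"
    using divides_primepow_nat[OF p] by auto
  then have "divisor_powr_sum \<sigma> (p ^ k) = (\<Sum>i\<le>k. real (p ^ i) powr (- \<sigma>))"
    unfolding divisor_powr_sum_def using p1 by (simp add: sum.reindex inj_on_def)
  also have "\<dots> = (\<Sum>i\<le>k. q ^ i)"
    using p1 by (intro sum.cong refl) (simp add: q_def powr_power powr_realpow[symmetric] powr_powr mult.commute)
  also have "\<dots> = (1 - q ^ Suc k) / (1 - q)" using q by (simp add: sum_gp0)
  also have "\<dots> \<le> 1 / (1 - q)" using q by (intro divide_right_mono) auto
  finally show ?thesis by (simp add: euler_factor_def q_def)
qed

lemma divisor_powr_sum_le_prod:
  assumes "U > 0" "\<sigma> > 0"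
  shows "divisor_powr_sum \<sigma> U \<le> (\<Prod>p\<in>prime_factors U. euler_factor \<sigma> p)"
proof -
  have "divisor_powr_sum \<sigma> (\<Prod>p\<in>S. p ^ f p) \<le> (\<Prod>p\<in>S. euler_factor \<sigma> p)"
    if "finite S" "\<forall>p\<in>S. prime p" for S and f :: "nat \<Rightarrow> nat"
    using that
  proof (induction S rule: finite_induct)
    case empty then show ?case by (simp add: divisor_powr_sum_def)
  next
    case (insert p S)
    have "(\<Prod>p\<in>S. p ^ f p) > 0" using insert by (intro prod_pos) (auto simp: prime_gt_0_nat)
    moreover have "p > 0" using insert by (auto simp: prime_gt_0_nat)
    ultimately have "divisor_powr_sum \<sigma> (p ^ f p * (\<Prod>p\<in>S. p ^ f p)) \<le>
        divisor_powr_sum \<sigma> (p ^ f p) * divisor_powr_sum \<sigma> (\<Prod>p\<in>S. p ^ f p)"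
      by (intro divisor_powr_sum_mult_le) auto
    also have "\<dots> \<le> euler_factor \<sigma> p * (\<Prod>p\<in>S. euler_factor \<sigma> p)"
      using insert assms divisor_powr_sum_ge_1[of "\<Prod>p\<in>S. p ^ f p" \<sigma>] \<open>(\<Prod>p\<in>S. p ^ f p) > 0\<close>
        euler_factor_ge_1[of p \<sigma>]
      by (intro mult_mono divisor_powr_sum_prime_power) (auto simp: prime_ge_2_nat)
    finally show ?case using insert by simp
  qed
  from this[of "prime_factors U" "\<lambda>p. multiplicity p U"] show ?thesis
    using assms prime_factorization_nat[of U] by auto
qed

text \<open>At most \<open>P\<close> prime factors lie below \<open>P\<close>, and for those the
  factor at 2 is a bound; for the others the factor at \<open>P\<close> is. The first power depends
  only on \<open>\<sigma>\<close> and \<open>P\<close>, while the base of the second tends to 1 as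
  \<open>P\<close> grows.\<close>

lemma divisor_powr_sum_le_power:
  assumes "U > 0" "\<sigma> > 0" "P \<ge> 2"
  shows "divisor_powr_sum \<sigma> U \<le> euler_factor \<sigma> 2 ^ P * euler_factor \<sigma> P ^ card (prime_factors U)"
proof -
  let ?S = "prime_factors U" and ?g = "euler_factor \<sigma>"
  have ge: "p \<ge> 2" if "p \<in> ?S" for p using that prime_ge_2_nat in_prime_factors_imp_prime by blast
  have g1: "?g 2 \<ge> 1" "?g P \<ge> 1" using assms by (auto intro: euler_factor_ge_1)
  have "divisor_powr_sum \<sigma> U \<le> (\<Prod>p\<in>?S. ?g p)" by (rule divisor_powr_sum_le_prod[OF assms(1,2)])
  also have "\<dots> \<le> (\<Prod>p\<in>?S. (if p < P then ?g 2 else 1) * ?g P)"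
  proof (rule prod_mono, intro conjI)
    fix p assume p: "p \<in> ?S"
    show "0 \<le> ?g p" using euler_factor_ge_1[OF ge[OF p] assms(2)] by simp
    show "?g p \<le> (if p < P then ?g 2 else 1) * ?g P"
    proof (cases "p < P")
      case True
      have "?g p * 1 \<le> ?g 2 * ?g P"
        using ge[OF p] g1 assms by (intro mult_mono euler_factor_antimono) auto
      then show ?thesis using True by simp
    next
      case False then show ?thesis using assms by (auto intro: euler_factor_antimono)
    qed
  qed
  also have "\<dots> = (\<Prod>p\<in>?S. if p < P then ?g 2 else 1) * ?g P ^ card ?S" by (simp add: prod.distrib)
  also have "(\<Prod>p\<in>?S. if p < P then ?g 2 else 1) = ?g 2 ^ card (?S \<inter> {p. p < P})"
    by (simp add: prod.If_cases)
  also have "\<dots> \<le> ?g 2 ^ P"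
  proof (rule power_increasing[OF _ g1(1)])
    have "card (?S \<inter> {p. p < P}) \<le> card {..<P}" by (rule card_mono) auto
    then show "card (?S \<inter> {p. p < P}) \<le> P" by simp
  qed
  finally show ?thesis using g1 by (simp add: mult_right_mono)
qed

section \<open>Rankin's trick for the cofactors\<close>

text \<open>Jensen's inequality in tangent form: \<open>exp (- y)\<close> lies above its tangent at
  the point \<open>c\<close> with \<open>t exp (- c) = S\<close>.\<close>

lemma sum_ge_of_sum_exp_le:
  fixes y :: "nat \<Rightarrow> real"
  assumes "(\<Sum>i<t. exp (- y i)) \<le> S" "t > 0" "S > 0"
  shows "real t * ln (real t / S) \<le> (\<Sum>i<t. y i)"
proof -
  define c where "c = ln (real t / S)"
  have ec: "exp (- c) = S / real t" using assms by (simp add: c_def exp_minus)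
  have "exp (- c) * (1 + c - y i) \<le> exp (- y i)" for i
  proof -
    have "1 + (c - y i) \<le> exp (c - y i)" by (rule exp_ge_add_one_self)
    then have "exp (- c) * (1 + (c - y i)) \<le> exp (- c) * exp (c - y i)" by (rule mult_left_mono) simp
    then show ?thesis by (simp add: exp_add[symmetric] add_diff_eq)
  qed
  then have "(\<Sum>i<t. exp (- c) * (1 + c - y i)) \<le> (\<Sum>i<t. exp (- y i))" by (rule sum_mono)
  then have "exp (- c) * (real t * (1 + c) - (\<Sum>i<t. y i)) \<le> S"
    using assms(1) by (simp add: sum_distrib_left[symmetric] sum_subtractf)
  then have "real t * (1 + c) - (\<Sum>i<t. y i) \<le> real t"
    using assms by (simp add: ec field_simps)
  then show ?thesis by (simp add: c_def algebra_simps)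
qed

text \<open>The zeta function at \<open>1 + \<sigma>\<close>; the term at 0 vanishes because
  \<open>0 powr _ = 0\<close>.\<close>

definition zeta_series :: "real \<Rightarrow> real" where
  "zeta_series \<sigma> = (\<Sum>v. real v powr (- (1 + \<sigma>)))"

lemma sum_powr_le_zeta_series:
  assumes "\<sigma> > 0" shows "(\<Sum>v\<in>{1..N}. real v powr (- (1 + \<sigma>))) \<le> zeta_series \<sigma>"
  unfolding zeta_series_def
  by (rule sum_le_suminf) (use assms in \<open>auto simp: summable_real_powr_iff\<close>)

lemma zeta_series_ge_1: "\<sigma> > 0 \<Longrightarrow> zeta_series \<sigma> \<ge> 1"
  using sum_powr_le_zeta_series[of \<sigma> 1] by simp

text \<open>Write \<open>x i = u i * v i\<close> with \<open>u i = gcd (x i) U\<close>. A pair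
  \<open>(u, v)\<close> determines the value \<open>x i\<close>, so it occurs at most
  \<open>d\<close> times, and the sum of \<open>u^(- \<sigma>) v^(-(1 + \<sigma>))\<close> over all
  \<open>i\<close> is at most \<open>S\<close>. Jensen's inequality then bounds from below the sum
  of \<open>\<sigma> ln u + (1 + \<sigma>) ln v = \<sigma> ln x + ln v\<close>.\<close>

lemma sum_ln_cofactor_ge:
  fixes x :: "nat \<Rightarrow> nat"
  assumes pos: "\<forall>i<t. x i > 0" and mult: "\<forall>v. card {i. i < t \<and> x i = v} \<le> d"
    and "t > 0" "d > 0" "U > 0" "\<sigma> > 0"
  defines "S \<equiv> real d * (divisor_powr_sum \<sigma> U * zeta_series \<sigma>)"
  shows "real t * ln (real t / S) - \<sigma> * (\<Sum>i<t. ln (real (x i)))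
      \<le> (\<Sum>i<t. ln (real (x i div gcd (x i) U)))"
proof -
  define u where "u = (\<lambda>i. gcd (x i) U)"
  define v where "v = (\<lambda>i. x i div gcd (x i) U)"
  have uv: "x i = u i * v i" for i by (simp add: u_def v_def)
  have uv0: "u i > 0" "v i > 0" if "i < t" for i
    using pos that uv[of i] by (auto intro!: gr0I)
  \<comment> \<open>A common upper bound for the \<open>v i\<close>, making the index set
    \<open>?D\<close> finite.\<close>
  define N where "N = (\<Sum>i<t. x i)"
  have vN: "v i \<in> {1..N}" if "i < t" for i
  proof -
    have "v i \<le> x i" by (simp add: v_def)
    also have "x i \<le> N" unfolding N_def using that by (intro member_le_sum) auto
    finally show ?thesis using uv0[OF that] by simp
  qed
  let ?D = "{u. u dvd U} \<times> {1..N}"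
  have finD: "finite ?D" using \<open>U > 0\<close> by simp
  define f where "f = (\<lambda>(u, v). real u powr (- \<sigma>) * real v powr (- (1 + \<sigma>)))"
  have f0: "f z \<ge> 0" for z by (auto simp: f_def split: prod.split)
  have S0: "S > 0"
    using divisor_powr_sum_ge_1[OF \<open>U > 0\<close>, of \<sigma>] zeta_series_ge_1[OF \<open>\<sigma> > 0\<close>] \<open>d > 0\<close>
    unfolding S_def by (intro mult_pos_pos) auto
  have "(\<Sum>i<t. f (u i, v i)) = (\<Sum>z\<in>?D. \<Sum>i\<in>{i \<in> {..<t}. (u i, v i) = z}. f (u i, v i))"
    by (rule sum.group[symmetric]) (use finD vN in \<open>auto simp: u_def\<close>)
  also have "\<dots> = (\<Sum>z\<in>?D. real (card {i \<in> {..<t}. (u i, v i) = z}) * f z)"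
    by (intro sum.cong refl) simp
  also have "\<dots> \<le> (\<Sum>z\<in>?D. real d * f z)"
  proof (intro sum_mono mult_right_mono f0)
    fix z :: "nat \<times> nat"
    have "card {i \<in> {..<t}. (u i, v i) = z} \<le> card {i. i < t \<and> x i = fst z * snd z}"
      by (intro card_mono) (auto simp: uv)
    also have "\<dots> \<le> d" using mult by blast
    finally show "real (card {i \<in> {..<t}. (u i, v i) = z}) \<le> real d" by simp
  qed
  also have "\<dots> = real d * (\<Sum>z\<in>?D. f z)" by (simp add: sum_distrib_left)
  also have "(\<Sum>z\<in>?D. f z) = divisor_powr_sum \<sigma> U * (\<Sum>v\<in>{1..N}. real v powr (- (1 + \<sigma>)))"
    by (simp add: f_def divisor_powr_sum_def sum_product sum.cartesian_product)
  also have "real d * \<dots> \<le> S"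
    unfolding S_def using divisor_powr_sum_ge_1[OF \<open>U > 0\<close>, of \<sigma>]
    by (intro mult_left_mono sum_powr_le_zeta_series) (use assms in auto)
  finally have le: "(\<Sum>i<t. f (u i, v i)) \<le> S" .
  define y where "y = (\<lambda>i. \<sigma> * ln (real (u i)) + (1 + \<sigma>) * ln (real (v i)))"
  have y: "exp (- y i) = f (u i, v i)" if "i < t" for i
    using uv0[OF that] by (simp add: f_def y_def powr_def exp_add[symmetric] algebra_simps)
  have "real t * ln (real t / S) \<le> (\<Sum>i<t. y i)"
    by (rule sum_ge_of_sum_exp_le) (use y le S0 \<open>t > 0\<close> in auto)
  also have "\<dots> = (\<Sum>i<t. \<sigma> * ln (real (x i)) + ln (real (v i)))"
  proof (intro sum.cong refl)
    fix i assume "i \<in> {..<t}"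
    then have "ln (real (x i)) = ln (real (u i)) + ln (real (v i))"
      using uv0[of i] by (simp add: uv[of i] ln_mult)
    then show "y i = \<sigma> * ln (real (x i)) + ln (real (v i))" by (simp add: y_def algebra_simps)
  qed
  also have "\<dots> = \<sigma> * (\<Sum>i<t. ln (real (x i))) + (\<Sum>i<t. ln (real (v i)))"
    by (simp add: sum.distrib sum_distrib_left)
  finally show ?thesis by (simp add: v_def)
qed

section \<open>Primes dividing many factors\<close>

lemma prod_primes_dvd:
  fixes y :: nat
  assumes "finite R" "\<forall>p\<in>R. prime p \<and> p dvd y"
  shows "(\<Prod>p\<in>R. p) dvd y"
  using assms
proof (induction R rule: finite_induct)
  case empty then show ?case by simp
next
  case (insert p R)
  have "coprime p (\<Prod>p\<in>R. p)"
    using insert by (intro prod_coprime_right primes_coprime) auto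
  then show ?case using insert by (simp add: divides_mult)
qed

text \<open>Double counting of pairs \<open>(p, i)\<close> with \<open>p\<close> dividing
  \<open>x i\<close>: each \<open>p\<close> in \<open>Q\<close> occurs more than \<open>T\<close>
  times, and \<open>x i\<close> has at most \<open>log 2 (x i)\<close> prime divisors. This limits
  the number of prime factors of \<open>U\<close>.\<close>

lemma card_frequent_primes:
  fixes x :: "nat \<Rightarrow> nat"
  assumes pos: "\<forall>i<t. x i > 0" and "finite Q"
    and Q: "\<forall>p\<in>Q. prime p \<and> T < card {i. i < t \<and> p dvd x i}"
  shows "real (card Q) * real T * ln 2 \<le> (\<Sum>i<t. ln (real (x i)))"
proof -
  have bound: "real (card {p \<in> Q. p dvd y}) * ln 2 \<le> ln (real y)" if "y > 0" for y
  proof -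
    let ?R = "{p \<in> Q. p dvd y}"
    have "(\<Prod>p\<in>?R. p) dvd y"
      by (rule prod_primes_dvd) (use Q \<open>finite Q\<close> in auto)
    then have "(\<Prod>p\<in>?R. p) \<le> y" using that by (rule dvd_imp_le)
    moreover have "2 ^ card ?R \<le> (\<Prod>p\<in>?R. p)"
      using prod_mono[of ?R "\<lambda>_. 2::nat" "\<lambda>p. p"] Q by (auto simp: prime_ge_2_nat)
    ultimately have "2 ^ card ?R \<le> y" by linarith
    then have "(2::real) ^ card ?R \<le> real y" by (metis of_nat_le_iff of_nat_numeral of_nat_power)
    then have "ln ((2::real) ^ card ?R) \<le> ln (real y)" by (subst ln_le_cancel_iff) (use that in auto)
    then show ?thesis by (simp add: ln_realpow)
  qed
  have "real (card Q) * real T = (\<Sum>p\<in>Q. real T)" by simp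
  also have "\<dots> \<le> (\<Sum>p\<in>Q. real (card {i \<in> {..<t}. p dvd x i}))"
    by (rule sum_mono) (use Q in \<open>auto simp: less_imp_le\<close>)
  also have "\<dots> = real (\<Sum>p\<in>Q. card {i \<in> {..<t}. p dvd x i})" by simp
  also have "(\<Sum>p\<in>Q. card {i \<in> {..<t}. p dvd x i}) = (\<Sum>i<t. card {p \<in> Q. p dvd x i})"
    by (rule sum_multicount_gen) (use \<open>finite Q\<close> in auto)
  finally have "real (card Q) * real T * ln 2 \<le> real (\<Sum>i<t. card {p \<in> Q. p dvd x i}) * ln 2"
    by (intro mult_right_mono) auto
  also have "\<dots> = (\<Sum>i<t. real (card {p \<in> Q. p dvd x i}) * ln 2)"
    by (simp add: sum_distrib_right)
  also have "\<dots> \<le> (\<Sum>i<t. ln (real (x i)))"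
    using bound pos by (intro sum_mono) auto
  finally show ?thesis .
qed

subsection \<open>The optimal constant\<close>

locale gamma_constants =
  fixes R c M :: real
  assumes R: "R \<ge> 1"
  defines "c \<equiv> sqrt (R * (R + 1)) - R" and "M \<equiv> 1 - 2 * c"
begin

text \<open>From \<open>(c + R)^2 = R (R + 1)\<close>; this relation turns the square
  \<open>(m - c e)^2\<close> into an inequality in \<open>M\<close>.\<close>

lemma c_squared: "c\<^sup>2 = R * M"
proof -
  have "(c + R)\<^sup>2 = R * (R + 1)" using R by (simp add: c_def)
  then show ?thesis by (simp add: M_def power2_eq_square algebra_simps)
qed

lemma gamma_R_eq: "gamma_R R = M / (4 * R)"
proof -
  have "gamma_R R = c\<^sup>2 / (4 * R\<^sup>2)" by (simp add: gamma_R_def c_def)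
  also have "\<dots> = M / (4 * R)" unfolding c_squared using R by (simp add: power2_eq_square)
  finally show ?thesis .
qed

lemma c_nonneg: "c \<ge> 0"
proof -
  have "sqrt (R * R) \<le> sqrt (R * (R + 1))" using R by (intro real_sqrt_le_mono) simp
  then show ?thesis using R by (simp add: c_def)
qed

lemma M_nonneg: "M \<ge> 0" and M_le_1: "M \<le> 1"
proof -
  have "0 \<le> R * M" using c_squared by (metis zero_le_power2)
  then show "M \<ge> 0" using R by (simp add: zero_le_mult_iff)
  show "M \<le> 1" using c_nonneg by (simp add: M_def)
qed

text \<open>\<open>M\<close> is the maximum of \<open>s (1 - s) / (s + R)\<close>, attained at \<open>s = c\<close>.\<close>

lemma rank_inequality:
  fixes m e t :: real
  assumes "0 \<le> m" "0 \<le> e" "e \<le> t"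
  shows "m * (e - m + 1) \<le> (M * t + 1) * m + M * R * t * e"
proof -
  have "0 \<le> (m - c * e)\<^sup>2" by simp
  also have "\<dots> = m\<^sup>2 - 2 * c * m * e + R * M * e\<^sup>2"
    unfolding c_squared[symmetric] by (simp add: power2_eq_square algebra_simps)
  also have "2 * c = 1 - M" by (simp add: M_def)
  finally have "m * (e - m) \<le> M * e * (m + R * e)" by (simp add: power2_eq_square algebra_simps)
  also have "\<dots> \<le> M * t * (m + R * e)"
    using assms M_nonneg R by (intro mult_right_mono mult_left_mono) auto
  finally show ?thesis by (simp add: algebra_simps)
qed

section \<open>From the count to an exponential bound\<close>

text \<open>With \<open>a = M t + 1\<close> and \<open>b = M R t\<close> the main terms of the
  exponent collect to \<open>M t (log r + R log |G| - R log |UG|)\<close>, whose first two summands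
  are at most \<open>log n\<close> in total by hypothesis. The rest is at most
  \<open>(T + 4) log n\<close>.\<close>

lemma card_bounded_subgroups_le_exp:
  fixes n r t T :: nat and x :: "nat \<Rightarrow> nat"
  assumes pos: "\<forall>i<t. x i > 0" and "r \<ge> 1"
    and n: "real r * real (\<Prod>i<t. x i) powr R \<le> real n"
  obtains U where "U > 0" "\<And>p. prime p \<Longrightarrow> p dvd U \<Longrightarrow> T < card {i. i < t \<and> p dvd x i}"
    "real (card {H. subgroup H (cyc_prod t x) \<and> card H \<le> r}) \<le>
      exp (M * real t * (ln (real n) - R * (\<Sum>i<t. ln (real (x i div gcd (x i) U)))) + (real T + 4) * ln (real n))"
    "(\<Sum>i<t. ln (real (x i))) \<le> ln (real n)"
    "0 \<le> (\<Sum>i<t. ln (real (x i div gcd (x i) U)))"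
proof -
  have "0 \<le> M * real t + 1" using M_nonneg by simp
  moreover have "real m * (real e - real m + 1) \<le> (M * real t + 1) * real m + M * R * real t * real e"
    if "m \<le> e" "e \<le> t" for e m :: nat
    using that by (intro rank_inequality) auto
  ultimately obtain U where U: "U > 0" "\<And>p. prime p \<Longrightarrow> p dvd U \<Longrightarrow> T < card {i. i < t \<and> p dvd x i}"
    and le: "real (card {H. subgroup H (cyc_prod t x) \<and> card H \<le> r}) \<le>
      real (\<Prod>i<t. x i div gcd (x i) U) powr (real T + 2) *
      (real r powr (M * real t + 1) *
       (real (\<Prod>i<t. x i) / real (\<Prod>i<t. x i div gcd (x i) U)) powr (M * R * real t + 1))"
    using card_bounded_subgroups_cyc_prod_le[OF pos, of "M * real t + 1" "M * R * real t" T r] by blast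
  define v where "v = (\<lambda>i. x i div gcd (x i) U)"
  have v: "v i \<ge> 1" "v i \<le> x i" if "i < t" for i
  proof -
    have "gcd (x i) U \<le> x i" using pos that by (intro gcd_le1_nat) auto
    then show "v i \<ge> 1" using U(1) unfolding v_def by (simp add: Suc_le_eq div_greater_zero_iff)
    show "v i \<le> x i" by (simp add: v_def)
  qed
  define X LP LV where "X = ln (real n)" and "LP = (\<Sum>i<t. ln (real (x i)))"
    and "LV = (\<Sum>i<t. ln (real (v i)))"
  define P V where "P = real (\<Prod>i<t. x i)" and "V = real (\<Prod>i<t. v i)"
  have P0: "P > 0" using pos by (auto simp: P_def intro!: prod_pos)
  have V0: "V > 0" using v by (force simp: V_def intro!: prod_pos)
  have lnP: "ln P = LP" using pos by (auto simp: P_def LP_def intro!: ln_prod)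
  have lnV: "ln V = LV" using v by (force simp: V_def LV_def intro!: ln_prod)
  have LV: "0 \<le> LV" "LV \<le> LP"
    using v pos unfolding LV_def LP_def by (force intro!: sum_nonneg sum_mono ln_mono)+
  have lr: "ln (real r) \<ge> 0" using assms by simp
  have "ln (real r) + R * LP = ln (real r * P powr R)"
    using assms P0 by (simp add: ln_mult ln_powr lnP)
  also have "\<dots> \<le> X"
    unfolding X_def using n \<open>r \<ge> 1\<close> P0 unfolding P_def[symmetric]
    by (intro ln_mono mult_pos_pos) auto
  finally have X: "ln (real r) + R * LP \<le> X" .
  \<comment> \<open>Here \<open>R \<ge> 1\<close> makes the error \<open>ln r + LP\<close> at most
    \<open>X\<close>.\<close>
  have "1 * LP \<le> R * LP" using R LV by (intro mult_right_mono) auto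
  then have LPX: "LP \<le> X" "ln (real r) + LP \<le> X" using X lr LV by auto
  have "V powr (real T + 2) * (real r powr (M * real t + 1) * (P / V) powr (M * R * real t + 1)) =
      exp ((real T + 2) * LV + (M * real t + 1) * ln (real r) + (M * R * real t + 1) * (LP - LV))"
    using P0 V0 \<open>r \<ge> 1\<close> by (simp add: powr_def ln_div lnP lnV exp_add)
  also have "(real T + 2) * LV + (M * real t + 1) * ln (real r) + (M * R * real t + 1) * (LP - LV) =
      M * real t * (ln (real r) + R * LP - R * LV) + (real T + 1) * LV + (ln (real r) + LP)"
    by (simp add: algebra_simps)
  also have "\<dots> \<le> M * real t * (X - R * LV) + (real T + 1) * X + X"
    using X LPX LV M_nonneg by (intro add_mono mult_left_mono) auto
  also have "\<dots> \<le> M * real t * (X - R * LV) + (real T + 4) * X"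
    using LPX LV by (simp add: algebra_simps)
  finally have "V powr (real T + 2) * (real r powr (M * real t + 1) * (P / V) powr (M * R * real t + 1))
      \<le> exp (M * real t * (X - R * LV) + (real T + 4) * X)" by simp
  with le have "real (card {H. subgroup H (cyc_prod t x) \<and> card H \<le> r}) \<le> \<dots>"
    unfolding P_def V_def v_def by linarith
  then show ?thesis
    using that[OF U] LPX(1) LV(1) unfolding X_def LP_def LV_def v_def by blast
qed

text \<open>\<open>Y\<close> stands for \<open>log log n\<close>. \<open>E1\<close> makes the
  constants negligible, \<open>E2\<close> makes \<open>ln t\<close> almost \<open>Y\<close> once
  \<open>t\<close> exceeds \<open>T\<close>, and \<open>E3\<close> collects the errors. For
  \<open>t \<le> T\<close> a trivial estimate is enough; otherwise the lower bound on
  \<open>log |UG|\<close> leaves a concave quadratic in \<open>t\<close>.\<close>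

lemma card_bounded_subgroups_le_asymp:
  fixes n r t d p0 :: nat and x :: "nat \<Rightarrow> nat" and \<delta> \<epsilon> X Y :: real
  assumes pos: "\<forall>i<t. x i > 0" and "r \<ge> 1"
    and mult: "\<forall>v. card {i. i < t \<and> x i = v} \<le> d" and "d \<ge> 1"
    and n: "real r * real (\<Prod>i<t. x i) powr R \<le> real n"
    and \<delta>: "0 < \<delta>" "3 * \<delta> < 1"
    and p0: "p0 \<ge> 2" "ln (euler_factor \<delta> p0) \<le> \<delta>\<^sup>2 * ln 2"
    and X: "X = ln (real n)" "X > 0" and Y: "Y > 0"
    and E1: "ln (real d) + ln (zeta_series \<delta>) + real p0 * ln (euler_factor \<delta> 2) \<le> \<delta> * Y"
    and E2: "(1 - \<delta>) * Y \<le> ln (\<delta> * X / Y)"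
    and E3: "gamma_R R * (1 + \<delta> * R)\<^sup>2 / (1 - 3 * \<delta>) * (X\<^sup>2 / Y) + 2 * \<delta> * (X\<^sup>2 / Y) + 6 * X \<le> B"
  shows "real (card {H. subgroup H (cyc_prod t x) \<and> card H \<le> r}) \<le> exp B"
proof -
  \<comment> \<open>Small enough that \<open>T X\<close> is an error of size
    \<open>\<delta> X^2 / Y\<close>, large enough that only \<open>O(Y)\<close> primes have rank
    above \<open>T\<close>.\<close>
  define T where "T = nat \<lceil>\<delta> * X / Y\<rceil>"
  have dXY: "\<delta> * X / Y > 0" using \<delta> X Y by simp
  have T: "\<delta> * X / Y \<le> real T" "real T \<le> \<delta> * X / Y + 1"
    unfolding T_def using dXY by linarith+
  obtain U where U: "U > 0" "\<And>p. prime p \<Longrightarrow> p dvd U \<Longrightarrow> T < card {i. i < t \<and> p dvd x i}"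
    and le: "real (card {H. subgroup H (cyc_prod t x) \<and> card H \<le> r}) \<le>
      exp (M * real t * (X - R * (\<Sum>i<t. ln (real (x i div gcd (x i) U)))) + (real T + 4) * X)"
    and LP: "(\<Sum>i<t. ln (real (x i))) \<le> X"
    and LV0: "0 \<le> (\<Sum>i<t. ln (real (x i div gcd (x i) U)))"
    using card_bounded_subgroups_le_exp[OF pos \<open>r \<ge> 1\<close> n, of T] unfolding X(1) by blast
  define LV where "LV = (\<Sum>i<t. ln (real (x i div gcd (x i) U)))"
  define Q where "Q = X\<^sup>2 / Y"
  have TX: "real T * X \<le> \<delta> * Q + X"
    using mult_right_mono[OF T(2), of X] X(2) by (simp add: Q_def power2_eq_square algebra_simps)
  have "Q > 0" using X Y by (simp add: Q_def)
  have "M * real t * (X - R * LV) \<le> gamma_R R * (1 + \<delta> * R)\<^sup>2 / (1 - 3 * \<delta>) * Q + real T * X"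
  proof (cases "t \<le> T")
    case True
    have "M * real t * (X - R * LV) \<le> M * real t * X"
      using M_nonneg R LV0 by (intro mult_left_mono) (auto simp: LV_def)
    also have "\<dots> \<le> 1 * real T * X"
      using M_nonneg M_le_1 True X by (intro mult_right_mono mult_mono) auto
    moreover have "0 \<le> gamma_R R * (1 + \<delta> * R)\<^sup>2 / (1 - 3 * \<delta>) * Q"
      unfolding gamma_R_eq using M_nonneg R \<delta> \<open>Q > 0\<close>
      by (intro mult_nonneg_nonneg divide_nonneg_nonneg) auto
    ultimately show ?thesis by linarith
  next
    case False
    then have t: "t > 0" "real T \<le> real t" by auto
    have lnt: "(1 - \<delta>) * Y \<le> ln (real t)"
      using E2 ln_mono[OF _ dXY, of "real t"] T t by linarith
    have zeta: "zeta_series \<delta> \<ge> 1" by (rule zeta_series_ge_1[OF \<delta>(1)])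
    have D: "divisor_powr_sum \<delta> U \<ge> 1" by (rule divisor_powr_sum_ge_1[OF U(1)])
    define k where "k = card (prime_factors U)"
    \<comment> \<open>Every prime factor of \<open>U\<close> divides more than \<open>T\<close> of
      the \<open>x i\<close>, which leads to \<open>k \<le> Y / (\<delta> ln 2)\<close>.\<close>
    have "real k * real T * ln 2 \<le> (\<Sum>i<t. ln (real (x i)))"
      unfolding k_def by (rule card_frequent_primes[OF pos]) (use U(2) in \<open>auto simp: in_prime_factors_iff\<close>)
    then have kT: "real k * real T * ln 2 \<le> X" using LP by simp
    have "real k * (\<delta> * X / Y) * ln 2 \<le> real k * real T * ln 2"
      using T by (intro mult_right_mono mult_left_mono) auto
    with kT have "real k * (\<delta> * X / Y) * ln 2 \<le> X" by simp
    then have k: "real k * \<delta> * ln 2 \<le> Y"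
      using X Y by (simp add: field_simps)
    have g: "euler_factor \<delta> 2 \<ge> 1" "euler_factor \<delta> p0 \<ge> 1"
      using \<delta> p0 by (auto intro: euler_factor_ge_1)
    have "ln (divisor_powr_sum \<delta> U) \<le> ln (euler_factor \<delta> 2 ^ p0 * euler_factor \<delta> p0 ^ k)"
      using D divisor_powr_sum_le_power[OF U(1) \<delta>(1) p0(1)] unfolding k_def by (intro ln_mono) auto
    also have "\<dots> = real p0 * ln (euler_factor \<delta> 2) + real k * ln (euler_factor \<delta> p0)"
      using g by (simp add: ln_mult ln_realpow)
    \<comment> \<open>By the choice of \<open>p0\<close> each prime costs at most
      \<open>\<delta>^2 ln 2\<close>, hence all \<open>k\<close> together at most
      \<open>\<delta> Y\<close>.\<close>
    also have "real k * ln (euler_factor \<delta> p0) \<le> real k * (\<delta>\<^sup>2 * ln 2)"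
      using p0(2) by (rule mult_left_mono) simp
    also have "real k * (\<delta>\<^sup>2 * ln 2) \<le> \<delta> * Y"
      using mult_left_mono[OF k, of \<delta>] \<delta> by (simp add: power2_eq_square algebra_simps)
    finally have lnD: "ln (divisor_powr_sum \<delta> U) \<le> real p0 * ln (euler_factor \<delta> 2) + \<delta> * Y" by simp
    let ?S = "real d * (divisor_powr_sum \<delta> U * zeta_series \<delta>)"
    have S0: "?S > 0" using \<open>d \<ge> 1\<close> D zeta by (intro mult_pos_pos) auto
    have "ln ?S = ln (real d) + (ln (divisor_powr_sum \<delta> U) + ln (zeta_series \<delta>))"
      using \<open>d \<ge> 1\<close> D zeta by (simp add: ln_mult)
    then have lnS: "ln ?S \<le> 2 * \<delta> * Y" using lnD E1 by simp
    have "real t * ((1 - 3 * \<delta>) * Y) - \<delta> * X \<le> real t * ln (real t / ?S) - \<delta> * (\<Sum>i<t. ln (real (x i)))"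
    proof (intro diff_mono mult_left_mono)
      \<comment> \<open>One \<open>\<delta>\<close> is lost in \<open>ln t\<close>, two in
        \<open>ln ?S\<close>.\<close>
      show "(1 - 3 * \<delta>) * Y \<le> ln (real t / ?S)"
        unfolding ln_divide_pos[OF of_nat_0_less_iff[THEN iffD2, OF t(1)] S0]
        using lnt lnS by (simp add: left_diff_distrib)
    qed (use LP \<delta> in auto)
    also have "\<dots> \<le> LV"
      unfolding LV_def by (rule sum_ln_cofactor_ge) (use pos mult t \<open>d \<ge> 1\<close> U \<delta> in auto)
    finally have LV: "real t * ((1 - 3 * \<delta>) * Y) - \<delta> * X \<le> LV" .
    \<comment> \<open>Coefficients of the quadratic \<open>t (a - b t)\<close>, whose maximum is
      \<open>a^2 / (4 b)\<close>; the \<open>R\<close> in \<open>b\<close> produces the constant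
      \<open>M / (4 R)\<close>.\<close>
    define a b where "a = X * (1 + \<delta> * R)" and "b = R * (1 - 3 * \<delta>) * Y"
    have b: "b > 0" using R \<delta> Y by (simp add: b_def)
    have "X - R * LV \<le> X - R * (real t * ((1 - 3 * \<delta>) * Y) - \<delta> * X)"
      using LV R by (intro diff_left_mono mult_left_mono) auto
    also have "\<dots> = a - b * real t" by (simp add: a_def b_def algebra_simps)
    finally have "real t * (X - R * LV) \<le> real t * (a - b * real t)" by (rule mult_left_mono) simp
    also have "\<dots> \<le> a\<^sup>2 / (4 * b)"
    proof -
      have "0 \<le> (a - 2 * b * real t)\<^sup>2" by simp
      then show ?thesis using b by (simp add: field_simps power2_eq_square)
    qed
    finally have "M * (real t * (X - R * LV)) \<le> M * (a\<^sup>2 / (4 * b))"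
      using M_nonneg by (rule mult_left_mono)
    also have "\<dots> = gamma_R R * (1 + \<delta> * R)\<^sup>2 / (1 - 3 * \<delta>) * Q"
      using R \<delta> Y by (simp add: gamma_R_eq a_def b_def Q_def power_mult_distrib mult_ac)
    finally have "M * real t * (X - R * LV) \<le> gamma_R R * (1 + \<delta> * R)\<^sup>2 / (1 - 3 * \<delta>) * Q"
      by (simp only: mult.assoc)
    moreover have "0 \<le> real T * X" using X(2) by (intro mult_nonneg_nonneg) auto
    ultimately show ?thesis by linarith
  qed
  then have "M * real t * (X - R * LV) + (real T + 4) * X \<le> B"
    using TX E3 unfolding Q_def[symmetric] by (simp add: algebra_simps)
  then show ?thesis using le unfolding LV_def by (smt (verit) exp_le_cancel_iff)
qed

end

section \<open>Choice of the parameters\<close>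

theorem theorem7p3:
  fixes R :: real and d :: nat and \<epsilon> :: real
  assumes "R \<ge> 1" and "d \<ge> 1" and "\<epsilon> > 0"
  shows "\<exists>N::nat. \<forall>n::nat. \<forall>r::nat. \<forall>t::nat. \<forall>x::nat \<Rightarrow> nat.
     n \<ge> N \<longrightarrow> r \<ge> 1 \<longrightarrow>
     (\<forall>i<t. x i > 0) \<longrightarrow>
     (\<forall>v. card {i. i < t \<and> x i = v} \<le> d) \<longrightarrow>
     real r * real (card (carrier (cyc_prod t x))) powr R \<le> real n \<longrightarrow>
     real (card {H. subgroup H (cyc_prod t x) \<and> card H \<le> r})
       \<le> real n powr ((gamma_R R + \<epsilon>) * ell (real n))"
proof -
  interpret gamma_constants R "sqrt (R * (R + 1)) - R" "1 - 2 * (sqrt (R * (R + 1)) - R)"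
    by unfold_locales (rule assms(1))
  \<comment> \<open>The coefficient of \<open>X^2 / Y\<close> left after all losses. It tends to
    \<open>gamma_R R\<close> as \<open>\<delta>\<close> tends to 0, so a fixed
    \<open>\<delta>\<close> brings it below \<open>gamma_R R + \<epsilon>\<close>.\<close>
  define F where "F = (\<lambda>\<delta>. gamma_R R * (1 + \<delta> * R)\<^sup>2 / (1 - 3 * \<delta>) + 2 * \<delta>)"
  have "(F \<longlongrightarrow> gamma_R R) (at_right 0)"
    unfolding F_def by (auto intro!: tendsto_eq_intros)
  then have "\<forall>\<^sub>F \<delta> in at_right 0. F \<delta> < gamma_R R + \<epsilon>"
    by (rule order_tendstoD) (use assms in simp)
  moreover have "\<forall>\<^sub>F \<delta> in at_right 0. \<delta> \<in> {0<..<1/3::real}"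
    by (rule eventually_at_right_real) simp
  ultimately have "\<forall>\<^sub>F \<delta> in at_right 0. F \<delta> < gamma_R R + \<epsilon> \<and> \<delta> \<in> {0<..<1/3::real}"
    by eventually_elim simp
  then obtain \<delta> where \<delta>: "F \<delta> < gamma_R R + \<epsilon>" "0 < \<delta>" "3 * \<delta> < 1"
    using eventually_happens'[OF trivial_limit_at_right_real] by fastforce
  \<comment> \<open>Euler factors tend to 1, so \<open>p0\<close> can be chosen in terms of
    \<open>\<delta>\<close> alone, before \<open>n\<close>.\<close>
  have "((\<lambda>p::nat. ln (euler_factor \<delta> p)) \<longlongrightarrow> 0) sequentially"
    unfolding euler_factor_def using \<delta>(2) by real_asymp
  then have "\<forall>\<^sub>F p in sequentially. ln (euler_factor \<delta> p) < \<delta>\<^sup>2 * ln 2"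
    by (rule order_tendstoD) (use \<delta> in simp)
  then have "\<forall>\<^sub>F p in sequentially. ln (euler_factor \<delta> p) < \<delta>\<^sup>2 * ln 2 \<and> p \<ge> 2"
    using eventually_ge_at_top[of 2] by eventually_elim simp
  then obtain p0 where p0: "p0 \<ge> 2" "ln (euler_factor \<delta> p0) \<le> \<delta>\<^sup>2 * ln 2"
    using eventually_happens'[OF sequentially_bot] by fastforce
  define C where "C = ln (real d) + ln (zeta_series \<delta>) + real p0 * ln (euler_factor \<delta> 2)"
  \<comment> \<open>The slack that absorbs the term \<open>6 X\<close>, which is of lower order than
    \<open>X^2 / Y\<close>.\<close>
  define \<eta> where "\<eta> = gamma_R R + \<epsilon> - F \<delta>"
  have \<eta>: "\<eta> > 0" using \<delta>(1) by (simp add: \<eta>_def)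
  have "\<forall>\<^sub>F n in sequentially. ln (real n) > 0"
    "\<forall>\<^sub>F n in sequentially. ln (ln (real n)) > 0"
    by real_asymp+
  moreover have "\<forall>\<^sub>F n in sequentially. C \<le> \<delta> * ln (ln (real n))"
    using \<delta>(2) by real_asymp
  moreover have "\<forall>\<^sub>F n in sequentially. (1 - \<delta>) * ln (ln (real n)) \<le> ln (\<delta> * ln (real n) / ln (ln (real n)))"
    using \<delta>(2) by real_asymp
  moreover have "\<forall>\<^sub>F n in sequentially. 6 * ln (real n) \<le> \<eta> * ((ln (real n))\<^sup>2 / ln (ln (real n)))"
    using \<eta> by real_asymp
  ultimately have "\<forall>\<^sub>F n in sequentially. \<forall>r t. \<forall>x::nat \<Rightarrow> nat.
     r \<ge> 1 \<longrightarrow> (\<forall>i<t. x i > 0) \<longrightarrow> (\<forall>v. card {i. i < t \<and> x i = v} \<le> d) \<longrightarrow>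
     real r * real (card (carrier (cyc_prod t x))) powr R \<le> real n \<longrightarrow>
     real (card {H. subgroup H (cyc_prod t x) \<and> card H \<le> r})
       \<le> real n powr ((gamma_R R + \<epsilon>) * ell (real n))"
  proof eventually_elim
    case (elim n)
    show ?case
    proof (intro allI impI)
      fix r t :: nat and x :: "nat \<Rightarrow> nat"
      assume r: "r \<ge> 1" and pos: "\<forall>i<t. x i > 0" and mult: "\<forall>v. card {i. i < t \<and> x i = v} \<le> d"
        and le: "real r * real (card (carrier (cyc_prod t x))) powr R \<le> real n"
      have le': "real r * real (\<Prod>i<t. x i) powr R \<le> real n"
        using le order_cyc_prod[OF pos] by (simp add: order_def)
      have "real (card {H. subgroup H (cyc_prod t x) \<and> card H \<le> r}) \<le>
          exp ((gamma_R R + \<epsilon>) * ((ln (real n))\<^sup>2 / ln (ln (real n))))"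
        by (rule card_bounded_subgroups_le_asymp[OF pos r mult assms(2) le' \<delta>(2,3) p0 refl elim(1,2) _ elim(4)])
          (use elim(3,5) in \<open>simp_all add: C_def \<eta>_def F_def algebra_simps\<close>)
      \<comment> \<open>Only for a nonzero base does \<open>powr\<close> unfold to
        \<open>exp\<close>; the exponent \<open>ell (real n) * ln (real n)\<close> is then
        \<open>X^2 / Y\<close>.\<close>
      moreover have "n \<noteq> 0" using elim(1) by (intro notI) simp
      ultimately show "real (card {H. subgroup H (cyc_prod t x) \<and> card H \<le> r})
       \<le> real n powr ((gamma_R R + \<epsilon>) * ell (real n))"
        by (simp add: powr_def ell_def power2_eq_square mult.assoc)
    qed
  qed
  then show ?thesis unfolding eventually_sequentially by blast
qed

end
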